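(* Assume there exists a feasible point $M$ of the problem (P) described in the context such that $(M_t)_{ij}>0$ whenever $(A_t)_{ij}>0$ (for all $t,i,j$). Let $$\mathcal O_{T+1}=\begin{bmatrix}C\\ CA_0^\top\\ CA_1^\top A_0^\top\\ \vdots\\ CA_{T-1}^\top\cdots A_0^\top\end{bmatrix}.$$ If $\ker(\mathcal O_{T+1})=\{0\}$ (equivalently, the linear system $\mu_{t+1}=A_t^\top\mu_t$, $\rho_t=C\mu_t$ is observable over times $0,\dots,T$), then problem (P) has a unique optimizer.
   Context: Setting. Let $n,T\ge1$ be integers and let $A_0,\dots,A_{T-1}\in\mathbb{R}^{n\times n}_{\ge0}$ be row-stochastic matrices ($A_t\mathbf 1=\mathbf 1$). Let $\pi=\{\pi_1,\dots,\pi_k\}\subseteq\{1,\dots,n\}$ have $k$ elements and let $C=[e_{\pi_1},\dots,e_{\pi_k}]^\top\in\{0,1\}^{k\times n}$ be the coordinate-selection matrix of $\pi$. Let $\rho_0,\dots,\rho_T\in\mathbb{R}^k$ be given. Notation. $\mathbf 1$ is the all-ones vector; $\operatorname{supp}$ is the set of positions of nonzero entries. For nonnegative arrays $p,q$ of the same size with $\operatorname{supp}(p)\subseteq\operatorname{supp}(q)$, $\mathcal D(p\,|\,q)=\sum_i\big(p_i\log(p_i/q_i)-p_i+q_i\big)$, with $0\log 0:=0$ (terms with $p_i=q_i=0$ are $0$). Problem (P): minimize $\sum_{t=0}^{T-1}\mathcal D\big(M_t\,|\,\operatorname{diag}(M_t\mathbf 1)A_t\big)$ over $M_0,\dots,M_{T-1}\in\mathbb{R}^{n\times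 n}_{\ge0}$ with $\operatorname{supp}(M_t)\subseteq\operatorname{supp}(A_t)$, subject to (i) $CM_t\mathbf 1=\rho_t$ for $t=0,\dots,T-1$; (ii) $CM_{T-1}^\top\mathbf 1=\rho_T$; (iii) $M_t\mathbf 1=M_{t-1}^\top\mathbf 1$ for $t=1,\dots,T-1$. *)

theory Defs
  imports Complex_Main "HOL-Library.FuncSet" "Jordan_Normal_Form.Matrix_Kernel"
begin

text \<open>
  Matrices and vectors are those of \<^theory>\<open>Jordan_Normal_Form.Matrix\<close>, so
  states are numbered \<open>0, \<dots>, n - 1\<close>.
\<close>

definition ones_vec :: "nat \<Rightarrow> real vec" where
  "ones_vec n = vec n (\<lambda>_. 1)"

definition nonneg_matrix :: "real mat \<Rightarrow> bool" where
  "nonneg_matrix M \<longleftrightarrow> (\<forall>i<dim_row M. \<forall>j<dim_col M. 0 \<le> M $$ (i, j))"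

definition row_stochastic :: "nat \<Rightarrow> real mat \<Rightarrow> bool" where
  "row_stochastic n A \<longleftrightarrow>
     A \<in> carrier_mat n n \<and> nonneg_matrix A \<and> A *\<^sub>v ones_vec n = ones_vec n"

definition mat_supp :: "real mat \<Rightarrow> (nat \<times> nat) set" where
  "mat_supp M = {(i, j). i < dim_row M \<and> j < dim_col M \<and> M $$ (i, j) \<noteq> 0}"

text \<open>
  The generalized Kullback--Leibler divergence of nonnegative matrices of equal size. It is
  meaningful only if \<open>mat_supp P \<subseteq> mat_supp Q\<close>. In that case a summand with
  \<open>P $$ (i, j) = 0\<close> equals \<open>Q $$ (i, j)\<close>, which implements \<open>0 log 0 = 0\<close>.
\<close>

definition kl_div :: "real mat \<Rightarrow> real mat \<Rightarrow> real" where
  "kl_div P Q = (\<Sum>i<dim_row P. \<Sum>j<dim_col P.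
     P $$ (i, j) * ln (P $$ (i, j) / Q $$ (i, j)) - P $$ (i, j) + Q $$ (i, j))"

definition selection_mat :: "nat \<Rightarrow> nat list \<Rightarrow> real mat" where
  "selection_mat n \<pi> = mat_of_rows n (map (unit_vec n) \<pi>)"

text \<open>
  A candidate is a family \<open>M 0, \<dots>, M (T - 1)\<close>. The extensional function space makes the
  value of \<open>M\<close> outside \<open>{..<T}\<close> irrelevant, so that uniqueness is meaningful. If
  \<open>mat_supp (M t) \<subseteq> mat_supp (A t)\<close> and \<open>M t\<close> is nonnegative, then the support
  condition of the divergence in \<open>cost\<close> holds.
\<close>

definition feasible ::
    "nat \<Rightarrow> nat \<Rightarrow> (nat \<Rightarrow> real mat) \<Rightarrow> real mat \<Rightarrow> (nat \<Rightarrow> real vec) \<Rightarrow> (nat \<Rightarrow> real mat) \<Rightarrow> bool"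
  where
  "feasible n T A C \<rho> M \<longleftrightarrow>
     M \<in> {..<T} \<rightarrow>\<^sub>E carrier_mat n n \<and>
     (\<forall>t<T. nonneg_matrix (M t) \<and> mat_supp (M t) \<subseteq> mat_supp (A t)) \<and>
     (\<forall>t<T. C *\<^sub>v (M t *\<^sub>v ones_vec n) = \<rho> t) \<and>
     C *\<^sub>v ((M (T - 1))\<^sup>T *\<^sub>v ones_vec n) = \<rho> T \<and>
     (\<forall>t. 1 \<le> t \<and> t < T \<longrightarrow> M t *\<^sub>v ones_vec n = (M (t - 1))\<^sup>T *\<^sub>v ones_vec n)"

definition cost :: "nat \<Rightarrow> nat \<Rightarrow> (nat \<Rightarrow> real mat) \<Rightarrow> (nat \<Rightarrow> real mat) \<Rightarrow> real" where
  "cost n T A M =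
     (\<Sum>t<T. kl_div (M t) (mat_diag n (\<lambda>i. (M t *\<^sub>v ones_vec n) $ i) * A t))"

definition optimizer ::
    "nat \<Rightarrow> nat \<Rightarrow> (nat \<Rightarrow> real mat) \<Rightarrow> real mat \<Rightarrow> (nat \<Rightarrow> real vec) \<Rightarrow> (nat \<Rightarrow> real mat) \<Rightarrow> bool"
  where
  "optimizer n T A C \<rho> M \<longleftrightarrow> is_arg_min (cost n T A) (feasible n T A C \<rho>) M"

primrec transition_mat :: "nat \<Rightarrow> (nat \<Rightarrow> real mat) \<Rightarrow> nat \<Rightarrow> real mat" where
  "transition_mat n A 0 = 1\<^sub>m n"
| "transition_mat n A (Suc t) = (A t)\<^sup>T * transition_mat n A t"

text \<open>
  \<open>observability_mat n A C T\<close> stacks the \<open>T + 1\<close> blocks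
  \<open>C * (A (t - 1))\<^sup>T * \<dots> * (A 0)\<^sup>T\<close> for \<open>t = 0, \<dots>, T\<close>.
\<close>

primrec observability_mat :: "nat \<Rightarrow> (nat \<Rightarrow> real mat) \<Rightarrow> real mat \<Rightarrow> nat \<Rightarrow> real mat" where
  "observability_mat n A C 0 = C"
| "observability_mat n A C (Suc t) =
     observability_mat n A C t @\<^sub>r (C * transition_mat n A (Suc t))"

definition trajectory :: "nat \<Rightarrow> nat \<Rightarrow> (nat \<Rightarrow> real mat) \<Rightarrow> (nat \<Rightarrow> real vec) \<Rightarrow> bool" where
  "trajectory n T A \<mu> \<longleftrightarrow>
     (\<forall>t\<le>T. \<mu> t \<in> carrier_vec n) \<and> (\<forall>t<T. \<mu> (Suc t) = (A t)\<^sup>T *\<^sub>v \<mu> t)"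

text \<open>
  Observability over the times \<open>0, \<dots>, T\<close>: the outputs determine the initial state. States
  range over the whole space, with no sign condition.
\<close>

definition observable :: "nat \<Rightarrow> nat \<Rightarrow> (nat \<Rightarrow> real mat) \<Rightarrow> real mat \<Rightarrow> bool" where
  "observable n T A C \<longleftrightarrow>
     (\<forall>\<mu> \<nu>. trajectory n T A \<mu> \<and> trajectory n T A \<nu> \<and> (\<forall>t\<le>T. C *\<^sub>v \<mu> t = C *\<^sub>v \<nu> t)
        \<longrightarrow> \<mu> 0 = \<nu> 0)"

end

theory Submission
  imports Defs
begin

text \<open>
  The objective is homogeneous of degree one and vanishes exactly on the flows \<open>M\<close> with
  \<open>M t = diag (M t 1) (A t)\<close>. An unbounded minimizing sequence would therefore yield, after
  normalization, a nonzero trajectory of the linear system with zero output; observability excludes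
  this, and an optimizer exists.

  Two optimizers \<open>x, y\<close> have the same transition kernels as their midpoint, by strict convexity
  across kernels. The midpoint is positive on every edge leaving a state that carries mass, so
  Lagrange multipliers exist there and write its kernels as diagonal rescalings of \<open>A t\<close>. The
  states of \<open>x - y\<close>, rescaled by the same potential, form a trajectory of the original system with
  zero output, and observability gives \<open>x = y\<close>.
\<close>

text \<open>The reference \<open>diag (M t 1) (A t)\<close> moves with \<open>M\<close>, so the
  objective is convex but only affine between flows that share their transition kernels, and its
  sublevel sets may be unbounded. Neither strict convexity nor coercivity is available, and
  observability has to replace both. This is possible because, for a fixed kernel, masses evolve
  linearly. An optimizer may have empty states and need not be interior, so first-order conditions
  are derived only for perturbations inside its support. The given positive feasible point makes
  this sufficient: mixing it in shows that an optimizer uses every edge of each row that carries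
  mass. No derivative is taken. Relative to a kernel the objective is a divergence plus a linear
  form, and the divergence has a quadratic upper bound.\<close>

definition kl_term :: "real \<Rightarrow> real \<Rightarrow> real" where
  "kl_term p q = p * ln (p / q) - p + q"

section \<open>Scalar divergence estimates\<close>

lemma kl_term_nonneg:
  assumes "0 \<le> p" "0 \<le> q" "q = 0 \<Longrightarrow> p = 0"
  shows "0 \<le> kl_term p q"
proof (cases "p = 0")
  case False
  with assms have "0 < p" "0 < q" by (auto simp: less_le)
  then have "ln (q / p) \<le> q / p - 1"
    by (intro ln_le_minus_one) simp
  moreover have "ln (p / q) = - ln (q / p)"
    using \<open>0 < p\<close> \<open>0 < q\<close> by (simp add: ln_div)
  ultimately have "p * (1 - q / p) \<le> p * ln (p / q)"
    using \<open>0 < p\<close> by (intro mult_left_mono) auto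
  then show ?thesis
    using \<open>0 < p\<close> by (simp add: kl_term_def right_diff_distrib)
qed (use assms in \<open>simp add: kl_term_def\<close>)

lemma kl_term_eq_0_imp_eq:
  assumes "0 \<le> p" "0 \<le> q" "q = 0 \<Longrightarrow> p = 0" "kl_term p q = 0"
  shows "p = q"
proof (cases "p = 0")
  case False
  with assms have pq: "0 < p" "0 < q" by (auto simp: less_le)
  then have "p * ln (q / p) = p * (q / p - 1)"
    using assms(4) by (simp add: kl_term_def ln_div algebra_simps)
  then have "ln (q / p) = q / p - 1"
    using pq by simp
  then have "q / p = 1"
    using pq by (intro ln_eq_minus_one) auto
  then show ?thesis using pq by simp
qed (use assms in \<open>simp add: kl_term_def\<close>)

text \<open>Stands in for a Taylor expansion: a perturbation of size \<open>h\<close> changes the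
  divergence from a positive reference only at order \<open>h^2\<close>, which leaves the linear
  term decisive in the first-order condition.\<close>

lemma kl_term_le_square:
  assumes "0 \<le> p" "0 < q"
  shows "kl_term p q \<le> (p - q)\<^sup>2 / q"
proof -
  have "p * ln (p / q) \<le> p * (p / q - 1)"
    using assms by (cases "p = 0") (auto intro!: mult_left_mono ln_le_minus_one)
  then have "kl_term p q \<le> p * (p / q - 1) - p + q"
    by (simp add: kl_term_def)
  also have "\<dots> = (p - q)\<^sup>2 / q"
    using assms by (simp add: field_simps power2_eq_square)
  finally show ?thesis .
qed

lemma kl_term_scale: "0 < c \<Longrightarrow> kl_term (c * p) (c * q) = c * kl_term p q"
  by (simp add: kl_term_def algebra_simps)

section \<open>Limits, compactness and multipliers in finitely many coordinates\<close>

lemma tendsto_x_ln_x: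
  fixes X :: "nat \<Rightarrow> real"
  assumes "X \<longlonglongrightarrow> x" "\<And>n. 0 \<le> X n"
  shows "(\<lambda>n. X n * ln (X n)) \<longlonglongrightarrow> x * ln x"
proof (cases "x = 0")
  case True
  \<comment> \<open>The inequality \<open>ln v \<le> v - 1\<close> is used at
    \<open>1 / sqrt u\<close>: at \<open>1 / u\<close> it would bound \<open>- u * ln u\<close> only
    by \<open>1 - u\<close>, which does not tend to 0 with \<open>u\<close>. The square handles
    positive values of the logarithm.\<close>
  have bound: "\<bar>u * ln u\<bar> \<le> 2 * sqrt u + u\<^sup>2" if "0 \<le> u" for u :: real
  proof (cases "u = 0")
    case False
    with that have u: "0 < u" by simp
    have "ln (1 / sqrt u) \<le> 1 / sqrt u"
      using u ln_le_minus_one[of "1 / sqrt u"] by simp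
    then have "- ln u \<le> 2 / sqrt u"
      using u by (simp add: ln_div ln_sqrt)
    then have "u * (- ln u) \<le> u * (2 / sqrt u)"
      using u by (intro mult_left_mono) auto
    also have "u * (2 / sqrt u) = 2 * sqrt u"
      using u real_div_sqrt[of u] by (simp add: mult.commute[of u])
    finally have 1: "- (u * ln u) \<le> 2 * sqrt u" by simp
    have "u * ln u \<le> u * u"
      using u ln_le_minus_one[of u] by (intro mult_left_mono) auto
    then have 2: "u * ln u \<le> u\<^sup>2" by (simp add: power2_eq_square)
    have "0 \<le> sqrt u" "0 \<le> u\<^sup>2" using u by auto
    with 1 2 show ?thesis by linarith
  qed simp
  have "(\<lambda>n. 2 * sqrt (X n) + (X n)\<^sup>2) \<longlonglongrightarrow> 2 * sqrt x + x\<^sup>2"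
    by (intro tendsto_intros assms)
  then have "(\<lambda>n. 2 * sqrt (X n) + (X n)\<^sup>2) \<longlonglongrightarrow> 0"
    using True by simp
  then have "(\<lambda>n. X n * ln (X n)) \<longlonglongrightarrow> 0"
    by (rule tendsto_0_le[where K = 1]) (use bound assms(2) in \<open>fastforce intro!: always_eventually\<close>)
  then show ?thesis using True by simp
next
  case False
  then show ?thesis by (intro tendsto_intros assms)
qed

text \<open>Bolzano-Weierstrass, one coordinate at a time: a monotone subsequence of a bounded
  sequence converges, and coordinates treated earlier keep their limits.\<close>

lemma convergent_subseq_on_finite:
  fixes X :: "nat \<Rightarrow> 'e \<Rightarrow> real"
  assumes "finite E" "\<And>n e. e \<in> E \<Longrightarrow> \<bar>X n e\<bar> \<le> B"
  shows "\<exists>\<sigma>. strict_mono \<sigma> \<and> (\<forall>e\<in>E. convergent (\<lambda>n. X (\<sigma> n) e))"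
  using assms
proof (induction E)
  case empty
  show ?case by (intro exI[of _ id]) (auto simp: strict_mono_def)
next
  case (insert e E)
  then obtain \<sigma> where \<sigma>: "strict_mono \<sigma>" "\<forall>e\<in>E. convergent (\<lambda>n. X (\<sigma> n) e)"
    by auto
  obtain \<tau> where \<tau>: "strict_mono \<tau>" "monoseq (\<lambda>n. X (\<sigma> (\<tau> n)) e)"
    using seq_monosub[of "\<lambda>n. X (\<sigma> n) e"] by auto
  have "Bseq (\<lambda>n. X (\<sigma> (\<tau> n)) e)"
    using insert.prems by (intro BseqI'[of _ B]) auto
  then have "convergent (\<lambda>n. X (\<sigma> (\<tau> n)) e)"
    using \<tau>(2) by (rule Bseq_monoseq_convergent)
  moreover have "convergent (\<lambda>n. X (\<sigma> (\<tau> n)) e')" if "e' \<in> E" for e'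
    using convergent_subseq_convergent[of "\<lambda>n. X (\<sigma> n) e'" \<tau>] \<sigma>(2) \<tau>(1) that
    by (auto simp: o_def)
  ultimately show ?case
    using strict_mono_o[OF \<sigma>(1) \<tau>(1)] by (intro exI[of _ "\<sigma> \<circ> \<tau>"]) (auto simp del: strict_mono_o simp: strict_mono_def)
qed

text \<open>The algebraic core of Lagrange multipliers. The induction shrinks \<open>V\<close> to
  the zeros of \<open>g k\<close>. If \<open>g k w\<close> is nonzero, every \<open>v\<close>
  becomes such a zero after subtracting a multiple of \<open>w\<close>, and the coefficient of
  \<open>g k\<close> is the one that makes the identity true at \<open>w\<close>.\<close>

lemma linear_functional_combination:
  fixes V :: "('e \<Rightarrow> real) set"
  assumes "finite K"
    and "\<And>u v s. u \<in> V \<Longrightarrow> v \<in> V \<Longrightarrow> (\<lambda>e. u e + s * v e) \<in> V"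
    and "\<And>u v s. f (\<lambda>e. u e + s * v e) = f u + s * f v"
    and "\<And>k u v s. g k (\<lambda>e. u e + s * v e) = g k u + s * g k v"
    and "\<And>v. v \<in> V \<Longrightarrow> \<forall>k\<in>K. g k v = 0 \<Longrightarrow> f v = (0::real)"
  shows "\<exists>c. \<forall>v\<in>V. f v = (\<Sum>k\<in>K. c k * g k v)"
  using assms(1,2,5)
proof (induction K arbitrary: V)
  case empty
  then show ?case by simp
next
  case (insert k K)
  have "\<exists>c. \<forall>v\<in>{v \<in> V. g k v = 0}. f v = (\<Sum>k\<in>K. c k * g k v)"
    by (rule insert.IH) (use insert.prems assms(4) in auto)
  then obtain c where c: "\<And>v. v \<in> V \<Longrightarrow> g k v = 0 \<Longrightarrow> f v = (\<Sum>k\<in>K. c k * g k v)"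
    by auto
  have upd: "(\<Sum>j\<in>K. (c(k := s)) j * g j v) = (\<Sum>j\<in>K. c j * g j v)" for s v
    using insert.hyps by (intro sum.cong) auto
  show ?case
  proof (cases "\<forall>v\<in>V. g k v = 0")
    case True
    then show ?thesis
      using c insert.hyps upd by (intro exI[of _ "c(k := 0)"]) auto
  next
    case False
    then obtain w where w: "w \<in> V" "g k w \<noteq> 0" by auto
    let ?s = "(f w - (\<Sum>j\<in>K. c j * g j w)) / g k w"
    have "f v = ?s * g k v + (\<Sum>j\<in>K. c j * g j v)" if v: "v \<in> V" for v
    proof -
      let ?t = "- (g k v / g k w)"
      have "f (\<lambda>e. v e + ?t * w e) = (\<Sum>j\<in>K. c j * g j (\<lambda>e. v e + ?t * w e))"
        using v w assms(4)[of k v ?t w] by (intro c insert.prems(1)) auto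
      then have "f v + ?t * f w = (\<Sum>j\<in>K. c j * g j v) + ?t * (\<Sum>j\<in>K. c j * g j w)"
        unfolding assms(3,4) by (simp only: sum_distrib_left sum.distrib[symmetric])
          (simp add: algebra_simps)
      then show ?thesis using w(2) by (simp add: field_simps)
    qed
    then show ?thesis
      using insert.hyps upd by (intro exI[of _ "c(k := ?s)"]) auto
  qed
qed

section \<open>Relative entropy programs on edge weights\<close>

text \<open>The objective sees an edge only through its source; targets, time and observations are
  hidden in the functionals \<open>g\<close>. The point \<open>r\<close>, positive on all edges,
  also supplies the right-hand sides of the constraints.\<close>

locale entropy_program =
  fixes E :: "'e set" and src :: "'e \<Rightarrow> 'v" and a :: "'e \<Rightarrow> real"
    and K :: "'k set" and g :: "'k \<Rightarrow> 'e \<Rightarrow> real" and r :: "'e \<Rightarrow> real"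
  assumes finite_E: "finite E" and finite_K: "finite K"
    and a_pos: "\<And>e. e \<in> E \<Longrightarrow> 0 < a e"
    and a_row: "\<And>e. e \<in> E \<Longrightarrow> sum a {e' \<in> E. src e' = src e} = 1"
    and r_pos: "\<And>e. e \<in> E \<Longrightarrow> 0 < r e"
    and r_off: "\<And>e. e \<notin> E \<Longrightarrow> r e = 0"
begin

definition mass :: "('e \<Rightarrow> real) \<Rightarrow> 'v \<Rightarrow> real" where
  "mass x v = sum x {e \<in> E. src e = v}"

definition lin :: "'k \<Rightarrow> ('e \<Rightarrow> real) \<Rightarrow> real" where
  "lin k x = (\<Sum>e\<in>E. g k e * x e)"

text \<open>The reference weights \<open>w\<close> are a parameter because convexity arguments
  replace \<open>a\<close> by the kernel of another flow.\<close>

definition objective :: "('e \<Rightarrow> real) \<Rightarrow> ('e \<Rightarrow> real) \<Rightarrow> real" where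
  "objective w x = (\<Sum>e\<in>E. kl_term (x e) (w e * mass x (src e)))"

definition flow :: "('e \<Rightarrow> real) \<Rightarrow> bool" where
  "flow x \<longleftrightarrow> (\<forall>e. 0 \<le> x e) \<and> (\<forall>e. e \<notin> E \<longrightarrow> x e = 0)"

definition admissible :: "('e \<Rightarrow> real) \<Rightarrow> bool" where
  "admissible x \<longleftrightarrow> flow x \<and> (\<forall>k\<in>K. lin k x = lin k r)"

definition optimal :: "('e \<Rightarrow> real) \<Rightarrow> bool" where
  "optimal x \<longleftrightarrow> admissible x \<and> (\<forall>y. admissible y \<longrightarrow> objective a x \<le> objective a y)"

text \<open>At a source without mass the division yields 0, so kernel rows sum to one only where
  there is mass.\<close>

definition kernel :: "('e \<Rightarrow> real) \<Rightarrow> 'e \<Rightarrow> real" where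
  "kernel x e = x e / mass x (src e)"

section \<open>Masses, kernels and the splitting of the objective\<close>

lemma mass_affine: "mass (\<lambda>e. c * x e + s * y e) v = c * mass x v + s * mass y v"
  by (simp add: mass_def sum.distrib sum_distrib_left)

lemma lin_affine: "lin k (\<lambda>e. c * x e + s * y e) = c * lin k x + s * lin k y"
  unfolding lin_def sum_distrib_left sum.distrib[symmetric]
  by (intro sum.cong) (auto simp: algebra_simps)

lemma mass_scale: "mass (\<lambda>e. c * x e) v = c * mass x v"
  by (simp add: mass_def sum_distrib_left)

lemma lin_scale: "lin k (\<lambda>e. c * x e) = c * lin k x"
  by (simp add: lin_def sum_distrib_left mult.left_commute)

lemma mass_nonneg: "flow x \<Longrightarrow> 0 \<le> mass x v"
  by (auto simp: mass_def flow_def intro: sum_nonneg)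

lemma le_mass: "flow x \<Longrightarrow> e \<in> E \<Longrightarrow> x e \<le> mass x (src e)"
  using finite_E unfolding mass_def flow_def by (intro member_le_sum) auto

lemma mass_zero_imp: "flow x \<Longrightarrow> e \<in> E \<Longrightarrow> mass x (src e) = 0 \<Longrightarrow> x e = 0"
  using le_mass[of x e] by (simp add: flow_def antisym)

text \<open>Weights that sum to one over each row disappear when edges are grouped by source. The
  row condition is demanded only where \<open>x\<close> is nonzero, so that kernels with empty rows
  qualify as weights.\<close>

lemma sum_weighted_mass:
  assumes "\<And>e. e \<in> E \<Longrightarrow> x e \<noteq> 0 \<Longrightarrow> sum w {e' \<in> E. src e' = src e} = 1"
  shows "(\<Sum>e\<in>E. w e * mass x (src e) * h (src e)) = (\<Sum>e\<in>E. x e * h (src e))"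
proof -
  have "(\<Sum>e\<in>E. w e * mass x (src e) * h (src e)) =
        (\<Sum>e\<in>E. \<Sum>e'\<in>{e' \<in> E. src e = src e'}. w e * x e' * h (src e))"
    unfolding mass_def sum_distrib_left sum_distrib_right by (intro sum.cong) auto
  also have "\<dots> = (\<Sum>e'\<in>E. \<Sum>e\<in>{e \<in> E. src e = src e'}. w e * x e' * h (src e))"
    by (rule sum.swap_restrict[OF finite_E finite_E])
  also have "\<dots> = (\<Sum>e'\<in>E. \<Sum>e\<in>{e \<in> E. src e = src e'}. w e * (x e' * h (src e')))"
    by (intro sum.cong) (auto simp: mult.assoc)
  also have "\<dots> = (\<Sum>e'\<in>E. x e' * h (src e'))"
    unfolding sum_distrib_right[symmetric]
  proof (intro sum.cong refl)
    fix e assume "e \<in> E"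
    then show "sum w {e' \<in> E. src e' = src e} * (x e * h (src e)) = x e * h (src e)"
      using assms[of e] by (cases "x e = 0") auto
  qed
  finally show ?thesis .
qed

lemma kernel_row:
  assumes "mass z v \<noteq> 0"
  shows "sum (kernel z) {e \<in> E. src e = v} = 1"
proof -
  have "sum (kernel z) {e \<in> E. src e = v} = (\<Sum>e\<in>{e \<in> E. src e = v}. z e / mass z v)"
    by (intro sum.cong) (auto simp: kernel_def)
  also have "\<dots> = mass z v / mass z v"
    unfolding mass_def sum_divide_distrib ..
  finally show ?thesis using assms by simp
qed

lemma kernel_nonneg: "flow z \<Longrightarrow> 0 \<le> kernel z e"
  using mass_nonneg[of z "src e"] by (simp add: kernel_def flow_def)

lemma kernel_mass: "flow z \<Longrightarrow> e \<in> E \<Longrightarrow> kernel z e * mass z (src e) = z e"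
  using mass_zero_imp[of z e] by (auto simp: kernel_def)

lemma kernel_mass_zero_imp:
  assumes "flow x" "flow z" "e \<in> E" "z e = 0 \<Longrightarrow> x e = 0" "kernel z e * mass x (src e) = 0"
  shows "x e = 0"
  using assms mass_zero_imp[of x e] mass_zero_imp[of z e] by (auto simp: kernel_def)

lemma objective_kernel_term_nonneg:
  assumes "flow x" "flow z" "e \<in> E" "z e = 0 \<Longrightarrow> x e = 0"
  shows "0 \<le> kl_term (x e) (kernel z e * mass x (src e))"
  using assms(1) kernel_mass_zero_imp[OF assms]
  by (intro kl_term_nonneg mult_nonneg_nonneg kernel_nonneg mass_nonneg assms(1,2))
    (auto simp: flow_def)

lemma objective_kernel_nonneg:
  assumes "flow x" "flow z" "\<And>e. e \<in> E \<Longrightarrow> z e = 0 \<Longrightarrow> x e = 0"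
  shows "0 \<le> objective (kernel z) x"
  unfolding objective_def by (intro sum_nonneg objective_kernel_term_nonneg assms)

lemma objective_kernel_eq_0_imp:
  assumes "flow x" "flow z" "\<And>e. e \<in> E \<Longrightarrow> z e = 0 \<Longrightarrow> x e = 0"
    and "objective (kernel z) x = 0" "e \<in> E"
  shows "x e = kernel z e * mass x (src e)"
proof (rule kl_term_eq_0_imp_eq)
  show "kl_term (x e) (kernel z e * mass x (src e)) = 0"
    using assms objective_kernel_term_nonneg finite_E
    unfolding objective_def by (subst (asm) sum_nonneg_eq_0_iff) auto
  show "0 \<le> x e" using assms(1) by (simp add: flow_def)
  show "0 \<le> kernel z e * mass x (src e)"
    by (intro mult_nonneg_nonneg kernel_nonneg mass_nonneg assms)
  show "x e = 0" if "kernel z e * mass x (src e) = 0"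
    by (rule kernel_mass_zero_imp[OF assms(1,2,5) assms(3)[OF assms(5)] that])
qed

text \<open>
  Relative to the transition kernel of a flow \<open>z\<close>, the objective splits into a divergence that
  vanishes at \<open>z\<close> and a term that is linear in \<open>x\<close>. All convexity arguments below are
  instances of this identity.
\<close>

lemma objective_split:
  assumes "flow x" "flow z" "\<And>e. e \<in> E \<Longrightarrow> z e = 0 \<Longrightarrow> x e = 0"
  shows "objective a x = objective (kernel z) x + (\<Sum>e\<in>E. x e * ln (kernel z e / a e))"
proof -
  \<comment> \<open>The identity is termwise only after the reference masses are subtracted. Both of
    these total \<open>sum x E\<close> and cancel in the end; the factor 1 is the \<open>h\<close>
    of \<open>sum_weighted_mass\<close>.\<close>
  have eq: "kl_term (x e) (a e * mass x (src e)) - a e * mass x (src e) * 1 =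
      kl_term (x e) (kernel z e * mass x (src e)) + x e * ln (kernel z e / a e)
        - kernel z e * mass x (src e) * 1" if e: "e \<in> E" for e
  proof (cases "x e = 0")
    case False
    then have "x e \<noteq> 0" "z e \<noteq> 0" using assms(3)[OF e] by auto
    then have pos: "0 < x e" "0 < z e" using assms(1,2) by (auto simp: flow_def less_le)
    then have "0 < mass x (src e)" "0 < mass z (src e)"
      using le_mass[OF assms(1) e] le_mass[OF assms(2) e] by linarith+
    with pos have "0 < mass x (src e)" "0 < kernel z e" "0 < x e"
      by (auto simp: kernel_def)
    then show ?thesis using a_pos[OF e]
      by (simp add: kl_term_def ln_div ln_mult algebra_simps)
  qed (simp add: kl_term_def)
  have "(\<Sum>e\<in>E. a e * mass x (src e) * 1) = (\<Sum>e\<in>E. x e * 1)"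
    by (rule sum_weighted_mass) (use a_row in auto)
  moreover have "(\<Sum>e\<in>E. kernel z e * mass x (src e) * 1) = (\<Sum>e\<in>E. x e * 1)"
    using assms mass_zero_imp[of z] by (intro sum_weighted_mass kernel_row) auto
  moreover have "(\<Sum>e\<in>E. kl_term (x e) (a e * mass x (src e)) - a e * mass x (src e) * 1) =
      (\<Sum>e\<in>E. kl_term (x e) (kernel z e * mass x (src e)) + x e * ln (kernel z e / a e)
        - kernel z e * mass x (src e) * 1)"
    using eq by (intro sum.cong) auto
  ultimately show ?thesis
    unfolding objective_def sum.distrib sum_subtractf by linarith
qed

lemma objective_self:
  assumes "flow z"
  shows "objective a z = (\<Sum>e\<in>E. z e * ln (kernel z e / a e))"
proof -
  have "objective (kernel z) z = 0"
    using kernel_mass[OF assms] by (simp add: objective_def kl_term_def)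
  then show ?thesis using objective_split[of z z] assms by simp
qed

lemma objective_nonneg:
  assumes "flow x"
  shows "0 \<le> objective a x"
  unfolding objective_def
proof (intro sum_nonneg kl_term_nonneg)
  fix e assume e: "e \<in> E"
  show "0 \<le> x e" "0 \<le> a e * mass x (src e)"
    using assms a_pos[OF e] mass_nonneg[OF assms] by (auto simp: flow_def)
  show "x e = 0" if "a e * mass x (src e) = 0"
    using that a_pos[OF e] mass_zero_imp[OF assms e] by auto
qed

lemma objective_eq_0_imp:
  assumes "flow x" "objective a x = 0" "e \<in> E"
  shows "x e = a e * mass x (src e)"
proof -
  have nn: "0 \<le> a e * mass x (src e)" "a e * mass x (src e) = 0 \<Longrightarrow> x e = 0" if "e \<in> E" for e
    using assms a_pos[of e] mass_nonneg[OF assms(1)] mass_zero_imp[of x e] that by auto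
  have "0 \<le> kl_term (x e) (a e * mass x (src e))" if "e \<in> E" for e
    using nn[OF that] assms(1) by (intro kl_term_nonneg) (auto simp: flow_def)
  then have "kl_term (x e) (a e * mass x (src e)) = 0"
    using assms finite_E unfolding objective_def by (subst (asm) sum_nonneg_eq_0_iff) auto
  then show ?thesis
    by (rule kl_term_eq_0_imp_eq[rotated 3])
      (use assms(1) nn[OF assms(3)] in \<open>simp_all add: flow_def\<close>)
qed

lemma objective_scale: "0 < c \<Longrightarrow> objective a (\<lambda>e. c * x e) = c * objective a x"
  unfolding objective_def sum_distrib_left
  by (intro sum.cong refl) (simp add: mass_scale kl_term_scale[symmetric] mult.left_commute)

section \<open>Continuity of the objective\<close>

lemma flow_mass_limit:
  assumes "\<And>n. flow (X n)" "\<And>e. (\<lambda>n. X n e) \<longlonglongrightarrow> x e"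
  shows "flow x" "(\<lambda>n. mass (X n) v) \<longlonglongrightarrow> mass x v" "(\<lambda>n. lin k (X n)) \<longlonglongrightarrow> lin k x"
proof -
  show "(\<lambda>n. mass (X n) v) \<longlonglongrightarrow> mass x v" "(\<lambda>n. lin k (X n)) \<longlonglongrightarrow> lin k x"
    unfolding mass_def lin_def by (intro tendsto_intros assms)+
  show "flow x"
    unfolding flow_def
  proof safe
    fix e
    show "0 \<le> x e"
      using assms(1) by (intro LIMSEQ_le_const[OF assms(2)]) (auto simp: flow_def)
    assume "e \<notin> E"
    then have "(\<lambda>n. X n e) = (\<lambda>_. 0)" using assms(1) by (auto simp: flow_def)
    with assms(2)[of e] show "x e = 0" by (simp add: LIMSEQ_const_iff)
  qed
qed

text \<open>The ratio inside the logarithm has no controlled limit when a row tends to zero. Since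
  the rows of \<open>a\<close> sum to one, the logarithms of the masses can be regrouped so that
  only expressions \<open>u * ln u\<close> remain, and these are continuous up to
  \<open>u = 0\<close>.\<close>

lemma objective_eq_x_ln_x:
  assumes "flow x"
  shows "objective a x = (\<Sum>e\<in>E. x e * ln (x e) - x e * ln (a e)
           - a e * (mass x (src e) * ln (mass x (src e))))"
proof -
  have eq: "kl_term (x e) (a e * mass x (src e)) - a e * mass x (src e) * 1 =
      x e * ln (x e) - x e * ln (a e) - x e * ln (mass x (src e)) - x e * 1" if e: "e \<in> E" for e
  proof (cases "x e = 0")
    case False
    then have "0 < x e" using assms by (auto simp: flow_def less_le)
    moreover from this have "0 < mass x (src e)" using le_mass[OF assms e] by simp
    ultimately show ?thesis using a_pos[OF e]
      by (simp add: kl_term_def ln_div ln_mult algebra_simps)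
  qed (simp add: kl_term_def)
  have swap: "(\<Sum>e\<in>E. a e * mass x (src e) * h (src e)) = (\<Sum>e\<in>E. x e * h (src e))" for h
    using a_row by (intro sum_weighted_mass)
  have "(\<Sum>e\<in>E. kl_term (x e) (a e * mass x (src e)) - a e * mass x (src e) * 1) =
      (\<Sum>e\<in>E. x e * ln (x e) - x e * ln (a e) - x e * ln (mass x (src e)) - x e * 1)"
    using eq by (intro sum.cong) auto
  moreover have "(\<Sum>e\<in>E. a e * (mass x (src e) * ln (mass x (src e)))) =
      (\<Sum>e\<in>E. x e * ln (mass x (src e)))"
    using swap[of "\<lambda>v. ln (mass x v)"] unfolding mult.assoc .
  ultimately show ?thesis
    using swap[of "\<lambda>_. 1"] unfolding objective_def sum.distrib sum_subtractf by linarith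
qed

lemma objective_limit:
  assumes "\<And>n. flow (X n)" "\<And>e. (\<lambda>n. X n e) \<longlonglongrightarrow> x e"
  shows "(\<lambda>n. objective a (X n)) \<longlonglongrightarrow> objective a x"
proof -
  have "flow x" by (rule flow_mass_limit(1)[OF assms])
  have "(\<lambda>n. X n e * ln (X n e)) \<longlonglongrightarrow> x e * ln (x e)" for e
    using assms by (intro tendsto_x_ln_x) (auto simp: flow_def)
  moreover have "(\<lambda>n. mass (X n) v * ln (mass (X n) v)) \<longlonglongrightarrow> mass x v * ln (mass x v)" for v
    by (intro tendsto_x_ln_x flow_mass_limit(2)[OF assms] mass_nonneg assms(1))
  ultimately show ?thesis
    unfolding objective_eq_x_ln_x[OF assms(1)] objective_eq_x_ln_x[OF \<open>flow x\<close>]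
    by (intro tendsto_sum tendsto_diff tendsto_mult_left tendsto_mult_right assms(2))
qed

section \<open>Existence of an optimizer\<close>

lemma admissible_r: "admissible r"
  using r_pos r_off by (auto simp: admissible_def flow_def less_imp_le) (metis less_imp_le order_refl)

lemma admissible_combination:
  assumes "admissible x" "admissible y" "0 \<le> h" "h \<le> 1"
  shows "admissible (\<lambda>e. (1 - h) * x e + h * y e)"
proof -
  have "(1 - h) * lin k r + h * lin k r = lin k r" for k
    by (simp add: left_diff_distrib)
  then show ?thesis
    using assms by (auto simp: admissible_def flow_def lin_affine)
qed

text \<open>By homogeneity the objective is its own recession function. A minimizing sequence can
  thus escape only along a flow that satisfies the homogeneous constraints and has objective 0, that
  is, one whose kernel is \<open>a\<close>; \<open>no_recession\<close> forbids this.\<close>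

lemma ex_optimal:
  assumes no_recession: "\<And>d. flow d \<Longrightarrow> \<forall>k\<in>K. lin k d = 0 \<Longrightarrow>
      \<forall>e\<in>E. d e = a e * mass d (src e) \<Longrightarrow> \<forall>e\<in>E. d e = 0"
  shows "\<exists>x. optimal x"
proof -
  define c where "c = Inf (objective a ` {x. admissible x})"
  have bdd: "bdd_below (objective a ` {x. admissible x})"
    by (intro bdd_belowI[of _ 0]) (auto simp: admissible_def objective_nonneg)
  have c_le: "c \<le> objective a x" if "admissible x" for x
    unfolding c_def using bdd that by (intro cInf_lower) auto
  have "\<exists>x. admissible x \<and> objective a x < c + inverse (real (Suc n))" for n
    using cInf_lessD[of "objective a ` {x. admissible x}" "c + inverse (real (Suc n))"] admissible_r
    unfolding c_def by auto
  then obtain X where X: "\<And>n. admissible (X n)"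
      "\<And>n. objective a (X n) < c + inverse (real (Suc n))"
    by metis
  have "(\<lambda>n. c + inverse (real (Suc n))) \<longlonglongrightarrow> c + 0"
    by (intro tendsto_intros LIMSEQ_inverse_real_of_nat)
  then have ub: "(\<lambda>n. c + inverse (real (Suc n))) \<longlonglongrightarrow> c"
    unfolding add_0_right .
  have obj_X: "(\<lambda>n. objective a (X n)) \<longlonglongrightarrow> c"
    by (rule tendsto_sandwich[OF always_eventually always_eventually tendsto_const ub])
      (use c_le[OF X(1)] less_imp_le[OF X(2)] in blast)+
  \<comment> \<open>The minimizing sequence may be unbounded; its normalization converges either to a multiple
    of an optimizer or, if the normalizing weights vanish, to a recession direction.\<close>
  define w where "w n = 1 / (1 + sum (X n) E)" for n
  define Y where "Y n e = w n * X n e" for n e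
  have X_nonneg: "0 \<le> X n e" for n e using X(1) by (simp add: admissible_def flow_def)
  then have "0 \<le> sum (X n) E" for n by (simp add: sum_nonneg)
  then have w_pos: "0 < w n" for n
    unfolding w_def by (simp add: add_pos_nonneg)
  \<comment> \<open>Together \<open>w n\<close> and the entries of \<open>Y n\<close> sum to one.
    The pair lies in a simplex, and a limit with vanishing weight must keep total mass one in
    \<open>y\<close>.\<close>
  have w_eq: "w n = 1 - sum (Y n) E" for n
  proof -
    have "sum (Y n) E = w n * sum (X n) E"
      by (simp add: Y_def sum_distrib_left)
    then show ?thesis
      using \<open>0 \<le> sum (X n) E\<close> by (simp add: w_def field_simps)
  qed
  have Y_flow: "flow (Y n)" for n
    using X(1)[of n] w_pos[of n] by (auto simp: admissible_def flow_def Y_def)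
  have Y_le: "\<bar>Y n e\<bar> \<le> 1" if "e \<in> E" for n e
  proof -
    have "Y n e \<le> sum (Y n) E"
      using Y_flow[of n] finite_E that by (intro member_le_sum) (auto simp: flow_def)
    then show ?thesis using w_eq[of n] w_pos[of n] Y_flow[of n] by (simp add: flow_def)
  qed
  obtain \<sigma> where \<sigma>: "strict_mono \<sigma>" "\<And>e. e \<in> E \<Longrightarrow> convergent (\<lambda>n. Y (\<sigma> n) e)"
    using convergent_subseq_on_finite[OF finite_E, of Y 1] Y_le by blast
  define y where "y e = lim (\<lambda>n. Y (\<sigma> n) e)" for e
  have Y_lim: "(\<lambda>n. Y (\<sigma> n) e) \<longlonglongrightarrow> y e" for e
  proof (cases "e \<in> E")
    case True
    then show ?thesis using \<sigma>(2) by (simp add: y_def convergent_LIMSEQ_iff)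
  next
    case False
    then have "Y (\<sigma> n) e = 0" for n using Y_flow[of "\<sigma> n"] by (simp add: flow_def)
    then show ?thesis by (simp add: y_def)
  qed
  define W where "W = 1 - sum y E"
  have w_lim: "(\<lambda>n. w (\<sigma> n)) \<longlonglongrightarrow> W"
    unfolding w_eq W_def by (intro tendsto_intros Y_lim)
  have W_nonneg: "0 \<le> W"
    by (rule LIMSEQ_le_const[OF w_lim]) (use w_pos in \<open>auto intro: less_imp_le\<close>)
  note lims = flow_mass_limit[of "\<lambda>n. Y (\<sigma> n)" y, OF Y_flow Y_lim]
  have lin_y: "lin k y = W * lin k r" if "k \<in> K" for k
  proof (rule LIMSEQ_unique[OF lims(3)])
    have "lin k (Y n) = w n * lin k r" for n
      using X(1)[of n] that unfolding Y_def lin_scale by (simp add: admissible_def)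
    then show "(\<lambda>n. lin k (Y (\<sigma> n))) \<longlonglongrightarrow> W * lin k r"
      by (simp only:) (intro tendsto_intros w_lim)
  qed
  have obj_y: "objective a y = W * c"
  proof (rule LIMSEQ_unique[OF objective_limit[of "\<lambda>n. Y (\<sigma> n)" y, OF Y_flow Y_lim]])
    have "objective a (Y n) = w n * objective a (X n)" for n
      unfolding Y_def by (rule objective_scale[OF w_pos])
    then show "(\<lambda>n. objective a (Y (\<sigma> n))) \<longlonglongrightarrow> W * c"
      using LIMSEQ_subseq_LIMSEQ[OF obj_X \<sigma>(1)]
      by (simp only: o_def) (intro tendsto_intros w_lim)
  qed
  \<comment> \<open>With \<open>W = 0\<close> the limit \<open>y\<close> satisfies the homogeneous
    constraints and has objective \<open>0 * c = 0\<close>, hence is zero on all edges, against its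
    total mass one.\<close>
  have "W \<noteq> 0"
  proof
    assume W: "W = 0"
    have "\<forall>e\<in>E. y e = 0"
      using lims(1) lin_y obj_y objective_eq_0_imp[of y] unfolding W
      by (intro no_recession) auto
    then show False using W by (simp add: W_def)
  qed
  then have W_pos: "0 < inverse W" using W_nonneg by simp
  have "optimal (\<lambda>e. inverse W * y e)"
    using lims(1) W_pos lin_y c_le \<open>W \<noteq> 0\<close> objective_scale[OF W_pos, of y]
    by (simp add: optimal_def admissible_def flow_def lin_scale obj_y flip: mult.assoc)
  then show ?thesis by blast
qed

section \<open>Strict convexity across kernels and optimality conditions\<close>

lemma objective_convex_combination:
  assumes "flow x" "flow y" "0 < h" "h < 1"
    and z_def: "z = (\<lambda>e. (1 - h) * x e + h * y e)"
  shows "flow z" "z e = 0 \<Longrightarrow> x e = 0" "z e = 0 \<Longrightarrow> y e = 0"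
    and "(1 - h) * objective a x + h * objective a y =
      objective a z + (1 - h) * objective (kernel z) x + h * objective (kernel z) y"
proof -
  have nonneg: "0 \<le> (1 - h) * x e" "0 \<le> h * y e" for e
    using assms(1-4) by (auto simp: flow_def)
  then show z: "flow z"
    using assms(1,2) by (auto simp: flow_def z_def)
  have zero: "x e = 0" "y e = 0" if "z e = 0" for e
    using nonneg[of e] that assms(3,4) by (auto simp: z_def add_nonneg_eq_0_iff)
  then show "z e = 0 \<Longrightarrow> x e = 0" "z e = 0 \<Longrightarrow> y e = 0" by auto
  \<comment> \<open>Both points are split relative to the kernel of \<open>z\<close>. The linear
    parts average to \<open>objective a z\<close>, so the two divergences are exactly the Jensen
    gap.\<close>
  let ?l = "\<lambda>e. ln (kernel z e / a e)"
  have "objective a z = (\<Sum>e\<in>E. (1 - h) * (x e * ?l e) + h * (y e * ?l e))"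
    unfolding objective_self[OF z] by (intro sum.cong) (auto simp: z_def distrib_right)
  also have "\<dots> = (1 - h) * (\<Sum>e\<in>E. x e * ?l e) + h * (\<Sum>e\<in>E. y e * ?l e)"
    by (simp add: sum.distrib sum_distrib_left)
  finally show "(1 - h) * objective a x + h * objective a y =
      objective a z + (1 - h) * objective (kernel z) x + h * objective (kernel z) y"
    using objective_split[OF assms(1) z zero(1)] objective_split[OF assms(2) z zero(2)]
    by (simp add: distrib_left)
qed

text \<open>
  Rows of an optimizer may vanish, but a row carrying mass uses every edge: moving a little mass
  \<open>h\<close> onto an unused edge gains a multiple of \<open>h * ln (1 / h)\<close>.
\<close>

lemma optimal_full_support:
  assumes "optimal z" "e \<in> E" "0 < mass z (src e)"
  shows "0 < z e"
proof (rule ccontr)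
  assume "\<not> 0 < z e"
  moreover have z: "flow z" and adm: "admissible z"
    using assms(1) by (auto simp: optimal_def admissible_def)
  ultimately have ze: "z e = 0" by (auto simp: flow_def intro: antisym)
  have r: "flow r" using admissible_r by (simp add: admissible_def)
  have re: "0 < r e" by (rule r_pos[OF assms(2)])
  then have mr: "0 < mass r (src e)" using le_mass[OF r assms(2)] by simp
  \<comment> \<open>\<open>B\<close> bounds what optimality allows for the divergence of
    \<open>r\<close> from the kernel of the competitor \<open>y\<close>. \<open>L\<close> is chosen
    so that the edge \<open>e\<close> alone contributes at least \<open>B + 1\<close>, and
    \<open>h\<close> so small that its log ratio reaches \<open>L\<close>;
    \<open>h \<le> 1 / 2\<close> preserves half of the mass of \<open>z\<close>.\<close>
  define B where "B = \<bar>objective a r - objective a z\<bar>"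
  define L where "L = (B + r e + 1) / r e"
  define h where "h = min (1 / 2) (mass z (src e) / (2 * mass r (src e)) * exp (- L))"
  have h: "0 < h" "h \<le> 1 / 2" "h < 1"
    using assms(3) mr by (auto simp: h_def min_def)
  define y where "y = (\<lambda>e. (1 - h) * z e + h * r e)"
  note y = objective_convex_combination[OF z r h(1,3) y_def]
  have "objective a z \<le> objective a y"
    using assms(1) admissible_combination[OF adm admissible_r, of h] h
    by (auto simp: optimal_def y_def)
  moreover have "0 \<le> (1 - h) * objective (kernel y) z"
    using h by (intro mult_nonneg_nonneg objective_kernel_nonneg z y(1,2)) auto
  \<comment> \<open>Dropping the nonnegative part of the Jensen gap at \<open>z\<close> leaves a
    factor \<open>h\<close> on both sides, so the resulting bound \<open>B\<close> is independent of
    \<open>h\<close>.\<close>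
  ultimately have "h * objective (kernel y) r \<le> h * (objective a r - objective a z)"
    using y(4) by (simp add: algebra_simps)
  then have "objective (kernel y) r \<le> B"
    using h by (simp add: B_def)
  moreover have "kl_term (r e) (kernel y e * mass r (src e)) \<le> objective (kernel y) r"
    unfolding objective_def
    using objective_kernel_term_nonneg[OF r y(1) _ y(3)] finite_E assms(2)
    by (intro member_le_sum) auto
  moreover have "B + 1 \<le> kl_term (r e) (kernel y e * mass r (src e))"
  proof -
    have my: "mass z (src e) / 2 \<le> mass y (src e)"
    proof -
      have "1 / 2 * mass z (src e) \<le> (1 - h) * mass z (src e)"
        using h assms(3) by (intro mult_right_mono) auto
      moreover have "0 \<le> h * mass r (src e)" using h mr by simp
      ultimately show ?thesis unfolding y_def mass_affine by linarith
    qed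
    have hr: "0 < h * mass r (src e)" using h(1) mr by simp
    have "h \<le> mass z (src e) / (2 * mass r (src e)) * exp (- L)"
      by (simp add: h_def)
    then have "exp L * (h * mass r (src e)) \<le> mass z (src e) / 2"
      using mr by (simp add: exp_minus field_simps)
    with my have "exp L * (h * mass r (src e)) \<le> mass y (src e)" by linarith
    then have "exp L \<le> mass y (src e) / (h * mass r (src e))"
      using hr by (simp add: le_divide_eq)
    \<comment> \<open>As \<open>z e = 0\<close>, all of \<open>y e\<close> is
      \<open>h * r e\<close>; \<open>r e\<close> cancels and the ratio grows like
      \<open>1 / h\<close>.\<close>
    moreover have ratio: "r e / (kernel y e * mass r (src e)) = mass y (src e) / (h * mass r (src e))"
      using re by (simp add: kernel_def y_def ze)
    ultimately have "L \<le> ln (r e / (kernel y e * mass r (src e)))"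
      by (simp add: ln_ge_iff less_le_trans[OF exp_gt_zero])
    then have "r e * L \<le> r e * ln (r e / (kernel y e * mass r (src e)))"
      using re by (intro mult_left_mono) auto
    moreover have "r e * L = B + r e + 1" using re by (simp add: L_def)
    moreover have "0 \<le> kernel y e * mass r (src e)"
      using kernel_nonneg[OF y(1)] mr by simp
    ultimately show ?thesis by (simp add: kl_term_def)
  qed
  ultimately show False by simp
qed

text \<open>Since \<open>d\<close> vanishes off the support of \<open>z\<close>,
  \<open>z + h * d\<close> stays a flow for small \<open>h\<close> of either sign. Its objective
  differs from that of \<open>z\<close> by \<open>h\<close> times the sum plus a divergence of order
  \<open>h^2\<close>, so a nonzero sum would permit a decrease.\<close>

lemma optimal_stationary:
  assumes "optimal z" "\<And>e. z e = 0 \<Longrightarrow> d e = 0" "\<forall>k\<in>K. lin k d = 0"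
  shows "(\<Sum>e\<in>E. d e * ln (kernel z e / a e)) = 0" (is "?s = 0")
proof (rule ccontr)
  assume s: "?s \<noteq> 0"
  have z: "flow z" and adm: "admissible z"
    using assms(1) by (auto simp: optimal_def admissible_def)
  \<comment> \<open>\<open>B\<close> is the constant of the quadratic bound, its factor 2 coming
    from references that stay above \<open>z e / 2\<close>; \<open>D\<close> ensures that
    \<open>h * d\<close> is at most half of \<open>z\<close>. Quotients with \<open>z e = 0\<close>
    are 0. The choice \<open>h = - c * s\<close>, where \<open>s\<close> is the sum in question, is
    a gradient step, and \<open>c \<le> 1 / (B + 1)\<close> makes the change at most
    \<open>c * s^2 * (c * B - 1) < 0\<close>.\<close>
  define B where "B = (\<Sum>e\<in>E. 2 * (d e - kernel z e * mass d (src e))\<^sup>2 / z e)"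
  define D where "D = 1 + (\<Sum>e\<in>E. \<bar>d e\<bar> / z e)"
  have z_nonneg: "0 \<le> z e" for e using z by (simp add: flow_def)
  have B: "0 \<le> B" using z_nonneg by (simp add: B_def sum_nonneg)
  have D: "1 \<le> D" using z_nonneg by (simp add: D_def sum_nonneg)
  define c where "c = min (1 / (2 * D * \<bar>?s\<bar>)) (1 / (B + 1))"
  have c: "0 < c" "c \<le> 1 / (2 * D * \<bar>?s\<bar>)" "c \<le> 1 / (B + 1)"
    using s B D by (auto simp: c_def)
  define h where "h = - c * ?s"
  have h: "\<bar>h\<bar> \<le> 1 / (2 * D)"
    using c s D by (simp add: h_def abs_mult field_simps)
  define y where "y = (\<lambda>e. z e + h * d e)"
  have hd: "\<bar>h * d e\<bar> \<le> z e / 2" for e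
  proof (cases "z e = 0")
    case False
    then have ze: "0 < z e" and e: "e \<in> E" using z by (auto simp: flow_def less_le)
    have "\<bar>d e\<bar> / z e \<le> (\<Sum>e\<in>E. \<bar>d e\<bar> / z e)"
      using e finite_E z_nonneg by (intro member_le_sum) auto
    then have "\<bar>d e\<bar> \<le> D * z e" using ze by (simp add: D_def field_simps)
    then have "\<bar>h\<bar> * \<bar>d e\<bar> \<le> 1 / (2 * D) * (D * z e)"
      using h D by (intro mult_mono) auto
    then show ?thesis using D by (simp add: abs_mult)
  qed (simp add: assms(2))
  have y_ge: "z e / 2 \<le> y e" for e
    using hd[of e] by (simp add: y_def abs_le_iff)
  have y_zero: "y e = 0" if "z e = 0" for e
    using that assms(2) by (simp add: y_def)
  have y: "flow y"
    unfolding flow_def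
  proof safe
    fix e
    show "0 \<le> y e" using y_ge[of e] z_nonneg[of e] by linarith
    show "y e = 0" if "e \<notin> E" using that z y_zero by (simp add: flow_def)
  qed
  have "lin k y = lin k z + h * lin k d" for k
    using lin_affine[of k 1 z h d] by (simp add: y_def)
  then have "admissible y"
    using adm y assms(3) by (simp add: admissible_def)
  then have "objective a z \<le> objective a y"
    using assms(1) by (simp add: optimal_def)
  moreover have "objective a y = objective (kernel z) y + objective a z + h * ?s"
  proof -
    have "(\<Sum>e\<in>E. y e * ln (kernel z e / a e)) = objective a z + h * ?s"
      unfolding objective_self[OF z]
      by (simp add: y_def distrib_right sum.distrib sum_distrib_left mult.assoc)
    then show ?thesis using objective_split[OF y z y_zero] by simp
  qed
  moreover have "objective (kernel z) y \<le> h\<^sup>2 * B"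
    unfolding objective_def B_def sum_distrib_left
  proof (rule sum_mono)
    fix e assume e: "e \<in> E"
    show "kl_term (y e) (kernel z e * mass y (src e)) \<le>
        h\<^sup>2 * (2 * (d e - kernel z e * mass d (src e))\<^sup>2 / z e)"
    proof (cases "z e = 0")
      case False
      then have ze: "0 < z e" using z_nonneg[of e] by simp
      have mz: "0 < mass z (src e)" using ze le_mass[OF z e] by simp
      have "mass z (src e) / 2 \<le> mass y (src e)"
        unfolding mass_def sum_divide_distrib by (intro sum_mono y_ge)
      then have "kernel z e * (mass z (src e) / 2) \<le> kernel z e * mass y (src e)"
        by (intro mult_left_mono kernel_nonneg z)
      then have q: "z e / 2 \<le> kernel z e * mass y (src e)"
        using kernel_mass[OF z e] by simp
      have "mass y (src e) = mass z (src e) + h * mass d (src e)"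
        using mass_affine[of 1 z h d] by (simp add: y_def)
      then have diff: "y e - kernel z e * mass y (src e) = h * (d e - kernel z e * mass d (src e))"
        using kernel_mass[OF z e] by (simp add: y_def algebra_simps)
      have "kl_term (y e) (kernel z e * mass y (src e)) \<le>
          (y e - kernel z e * mass y (src e))\<^sup>2 / (kernel z e * mass y (src e))"
        using q ze y by (intro kl_term_le_square) (auto simp: flow_def)
      also have "\<dots> \<le> (y e - kernel z e * mass y (src e))\<^sup>2 / (z e / 2)"
        using q ze by (intro divide_left_mono) auto
      finally show ?thesis by (simp add: diff power_mult_distrib mult_ac)
    qed (simp add: kl_term_def kernel_def y_zero)
  qed
  ultimately have "0 \<le> h\<^sup>2 * B + h * ?s" by linarith
  also have "h\<^sup>2 * B + h * ?s = c * ?s\<^sup>2 * (c * B - 1)"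
    by (simp add: h_def power2_eq_square algebra_simps)
  also have "c * ?s\<^sup>2 * (c * B - 1) < 0"
  proof -
    have "c * (B + 1) \<le> 1" using c(3) B by (simp add: le_divide_eq)
    then have "c * B < 1" using c(1) by (simp add: distrib_left)
    then show ?thesis using c(1) s by (intro mult_pos_neg) auto
  qed
  finally show False by simp
qed

text \<open>Stationarity on all functions supported where \<open>z\<close> is nonzero makes the log
  ratio a combination of the constraints. The indicator of a single support edge is such a function,
  and testing with it gives the formula edge by edge.\<close>

lemma optimal_multipliers:
  assumes "optimal z"
  shows "\<exists>c. \<forall>e. z e \<noteq> 0 \<longrightarrow> kernel z e = a e * exp (\<Sum>k\<in>K. c k * g k e)"
proof -
  have z: "flow z" using assms by (simp add: optimal_def admissible_def)
  let ?f = "\<lambda>d. \<Sum>e\<in>E. d e * ln (kernel z e / a e)"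
  have "\<exists>c. \<forall>d\<in>{d. \<forall>e. z e = 0 \<longrightarrow> d e = 0}. ?f d = (\<Sum>k\<in>K. c k * lin k d)"
  proof (rule linear_functional_combination[OF finite_K])
    show "?f (\<lambda>e. u e + s * v e) = ?f u + s * ?f v" for u v s
      by (simp add: distrib_right sum.distrib sum_distrib_left mult.assoc)
    show "lin k (\<lambda>e. u e + s * v e) = lin k u + s * lin k v" for k u v s
      using lin_affine[of k 1 u s v] by simp
  qed (use optimal_stationary[OF assms] in auto)
  then obtain c where c: "\<And>d. \<forall>e. z e = 0 \<longrightarrow> d e = 0 \<Longrightarrow> ?f d = (\<Sum>k\<in>K. c k * lin k d)"
    by auto
  have "kernel z e = a e * exp (\<Sum>k\<in>K. c k * g k e)" if ze: "z e \<noteq> 0" for e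
  proof -
    have e: "e \<in> E" using ze z by (auto simp: flow_def)
    have "0 < z e" using ze z by (auto simp: flow_def less_le)
    then have pos: "0 < kernel z e" using le_mass[OF z e] by (simp add: kernel_def)
    have ind: "(\<Sum>e'\<in>E. (if e' = e then 1 else 0) * l e') = l e" "(\<Sum>e'\<in>E. l e' * (if e' = e then 1 else 0)) = l e"
      for l :: "'e \<Rightarrow> real"
      using e finite_E by (simp_all add: if_distrib if_distribR cong: if_cong)
    have "ln (kernel z e / a e) = (\<Sum>k\<in>K. c k * g k e)"
      using c[of "\<lambda>e'. if e' = e then 1 else 0"] ze unfolding ind lin_def by auto
    then have "exp (\<Sum>k\<in>K. c k * g k e) = kernel z e / a e"
      using pos a_pos[OF e] by (metis divide_pos_pos exp_ln)
    then show ?thesis using a_pos[OF e] by simp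
  qed
  then show ?thesis by blast
qed

lemma optimal_difference:
  assumes "optimal x" "optimal y"
  shows "\<exists>c. \<forall>e\<in>E. x e - y e =
    (mass x (src e) - mass y (src e)) * (a e * exp (\<Sum>k\<in>K. c k * g k e))"
proof -
  have x: "flow x" "admissible x" and y: "flow y" "admissible y"
    using assms by (auto simp: optimal_def admissible_def)
  define z where "z = (\<lambda>e. (1 - 1 / 2) * x e + 1 / 2 * y e)"
  have "0 < (1 / 2 :: real)" "1 / 2 < (1 :: real)" by auto
  note z = objective_convex_combination[OF x(1) y(1) this z_def]
  have adm: "admissible z"
    using admissible_combination[OF x(2) y(2), of "1 / 2"] by (simp add: z_def)
  have eq: "objective a x = objective a y"
    using assms by (auto simp: optimal_def intro: antisym)
  have le: "objective a x \<le> objective a z"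
    using assms(1) adm by (auto simp: optimal_def)
  have nonneg: "0 \<le> objective (kernel z) x" "0 \<le> objective (kernel z) y"
    using z(2,3) by (auto intro!: objective_kernel_nonneg x(1) y(1) z(1))
  have zero: "objective (kernel z) x = 0" "objective (kernel z) y = 0"
    and zx: "objective a z = objective a x"
    using z(4) eq le nonneg by auto
  have "optimal z"
    using adm assms(1) zx by (auto simp: optimal_def)
  then obtain c where c: "\<And>e. z e \<noteq> 0 \<Longrightarrow> kernel z e = a e * exp (\<Sum>k\<in>K. c k * g k e)"
    using optimal_multipliers by blast
  have "x e - y e = (mass x (src e) - mass y (src e)) * (a e * exp (\<Sum>k\<in>K. c k * g k e))"
    if e: "e \<in> E" for e
  proof (cases "z e = 0")
    case True
    then have "mass z (src e) = 0"
      using optimal_full_support[OF \<open>optimal z\<close> e] mass_nonneg[OF z(1), of "src e"] by force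
    then have "mass x (src e) = 0" "mass y (src e) = 0"
      using mass_nonneg[OF x(1), of "src e"] mass_nonneg[OF y(1), of "src e"]
      unfolding z_def mass_affine by auto
    then show ?thesis using z(2,3)[OF True] by simp
  next
    case False
    have "x e = kernel z e * mass x (src e)" "y e = kernel z e * mass y (src e)"
      using objective_kernel_eq_0_imp[OF x(1) z(1) z(2) zero(1) e]
        objective_kernel_eq_0_imp[OF y(1) z(1) z(3) zero(2) e] by auto
    then have "x e - y e = (mass x (src e) - mass y (src e)) * kernel z e"
      by (simp add: algebra_simps)
    then show ?thesis by (simp only: c[OF False])
  qed
  then show ?thesis by blast
qed

end

section \<open>Observability\<close>

lemma mult_mat_ones_vec:
  "M \<in> carrier_mat n n \<Longrightarrow> M *\<^sub>v ones_vec n = vec n (\<lambda>i. \<Sum>j<n. M $$ (i, j))"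
  "M \<in> carrier_mat n n \<Longrightarrow> M\<^sup>T *\<^sub>v ones_vec n = vec n (\<lambda>i. \<Sum>j<n. M $$ (j, i))"
  by (auto simp: ones_vec_def scalar_prod_def atLeast0LessThan intro!: eq_vecI)

lemma mult_mat_zero_vec:
  fixes M :: "real mat"
  shows "M \<in> carrier_mat k n \<Longrightarrow> M *\<^sub>v 0\<^sub>v n = 0\<^sub>v k"
  by (auto intro!: eq_vecI)

lemma selection_mat_carrier: "selection_mat n \<pi> \<in> carrier_mat (length \<pi>) n"
  using mat_of_rows_carrier(1)[of n "map (unit_vec n) \<pi>"] by (simp add: selection_mat_def)

lemma selection_mat_mult_eq_iff:
  assumes "set \<pi> \<subseteq> {..<n}" "v \<in> carrier_vec n" "w \<in> carrier_vec n"
  shows "selection_mat n \<pi> *\<^sub>v v = selection_mat n \<pi> *\<^sub>v w \<longleftrightarrow> (\<forall>l\<in>set \<pi>. v $ l = w $ l)"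
proof -
  have entry: "(selection_mat n \<pi> *\<^sub>v u) $ i = u $ (\<pi> ! i)"
    if "i < length \<pi>" "u \<in> carrier_vec n" for i u
  proof -
    have "\<pi> ! i < n" using assms(1) nth_mem[OF that(1)] by auto
    then show ?thesis using that by (simp add: selection_mat_def)
  qed
  have "selection_mat n \<pi> *\<^sub>v v = selection_mat n \<pi> *\<^sub>v w \<longleftrightarrow>
      (\<forall>i<length \<pi>. (selection_mat n \<pi> *\<^sub>v v) $ i = (selection_mat n \<pi> *\<^sub>v w) $ i)"
    using selection_mat_carrier[of n \<pi>] by (simp add: vec_eq_iff del: index_mult_mat_vec)
  then show ?thesis
    using assms(2,3) entry by (simp add: all_set_conv_all_nth)
qed

section \<open>Observability matrix and trajectories\<close>

lemma transition_mat_carrier: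
  "(\<And>s. s < t \<Longrightarrow> A s \<in> carrier_mat n n) \<Longrightarrow> transition_mat n A t \<in> carrier_mat n n"
  by (induction t) (auto intro!: mult_carrier_mat[of _ n n])

lemma observability_mat_carrier:
  assumes "C \<in> carrier_mat k n" "\<And>s. s < T \<Longrightarrow> A s \<in> carrier_mat n n"
  shows "observability_mat n A C T \<in> carrier_mat (Suc T * k) n"
  using assms(2)
proof (induction T)
  case (Suc T)
  then show ?case
    using assms(1) transition_mat_carrier[of "Suc T" A n]
    by (auto simp: add.commute[of k] simp del: transition_mat.simps
        intro!: carrier_append_rows mult_carrier_mat)
qed (use assms in simp)

lemma observability_mat_mult_eq_0_iff:
  assumes "C \<in> carrier_mat k n" "\<And>s. s < T \<Longrightarrow> A s \<in> carrier_mat n n" "v \<in> carrier_vec n"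
  shows "observability_mat n A C T *\<^sub>v v = 0\<^sub>v (Suc T * k) \<longleftrightarrow>
    (\<forall>t\<le>T. C *\<^sub>v (transition_mat n A t *\<^sub>v v) = 0\<^sub>v k)"
  using assms(2)
proof (induction T)
  case 0
  then show ?case using assms by simp
next
  case (Suc T)
  let ?O = "observability_mat n A C T" and ?P = "transition_mat n A (Suc T)"
  have O: "?O \<in> carrier_mat (Suc T * k) n" and P: "?P \<in> carrier_mat n n"
    using Suc.prems assms(1) by (intro observability_mat_carrier transition_mat_carrier; simp)+
  have CP: "C * ?P \<in> carrier_mat k n" using assms(1) P by simp
  have "observability_mat n A C (Suc T) *\<^sub>v v = (?O *\<^sub>v v) @\<^sub>v (C *\<^sub>v (?P *\<^sub>v v))"
    using mat_mult_append[OF O CP assms(3)] assoc_mult_mat_vec[OF assms(1) P assms(3)] by simp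
  moreover have "0\<^sub>v (Suc (Suc T) * k) = 0\<^sub>v (Suc T * k) @\<^sub>v (0\<^sub>v k :: real vec)"
    by (auto intro!: eq_vecI simp: append_vec_def Let_def)
  ultimately have "observability_mat n A C (Suc T) *\<^sub>v v = 0\<^sub>v (Suc (Suc T) * k) \<longleftrightarrow>
      ?O *\<^sub>v v = 0\<^sub>v (Suc T * k) \<and> C *\<^sub>v (?P *\<^sub>v v) = 0\<^sub>v k"
    using append_vec_eq[of "?O *\<^sub>v v" "Suc T * k" "0\<^sub>v (Suc T * k)"] O assms(3)
    by (metis mult_mat_vec_carrier zero_carrier_vec)
  then show ?case
    using Suc.IH Suc.prems by (auto simp: le_Suc_eq simp del: transition_mat.simps)
qed

lemma trajectory_eq_transition_mat:
  assumes "trajectory n T A \<mu>" "\<And>s. s < T \<Longrightarrow> A s \<in> carrier_mat n n" "t \<le> T"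
  shows "\<mu> t = transition_mat n A t *\<^sub>v \<mu> 0"
  using assms(3)
proof (induction t)
  case 0
  then show ?case using assms(1) by (simp add: trajectory_def)
next
  case (Suc t)
  have "transition_mat n A t \<in> carrier_mat n n" "(A t)\<^sup>T \<in> carrier_mat n n" "\<mu> 0 \<in> carrier_vec n"
    using Suc.prems assms by (auto simp: trajectory_def intro!: transition_mat_carrier)
  then show ?case using Suc assms(1) by (simp add: trajectory_def)
qed

lemma trajectory_transition_mat:
  assumes "\<And>s. s < T \<Longrightarrow> A s \<in> carrier_mat n n" "v \<in> carrier_vec n"
  shows "trajectory n T A (\<lambda>t. transition_mat n A t *\<^sub>v v)"
  unfolding trajectory_def
proof (intro conjI allI impI)
  fix t assume "t \<le> T"
  then show "transition_mat n A t *\<^sub>v v \<in> carrier_vec n"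
    using assms by (intro mult_mat_vec_carrier[of _ n n] transition_mat_carrier) auto
next
  fix t assume "t < T"
  then have "transition_mat n A t \<in> carrier_mat n n" "(A t)\<^sup>T \<in> carrier_mat n n"
    using assms by (auto intro!: transition_mat_carrier)
  then show "transition_mat n A (Suc t) *\<^sub>v v = (A t)\<^sup>T *\<^sub>v (transition_mat n A t *\<^sub>v v)"
    using assms(2) by simp
qed

text \<open>A trajectory is determined by its initial state, and its outputs are the blocks applied
  to that state. By linearity, initial states with equal outputs differ by a kernel vector;
  conversely a kernel vector is compared with the zero trajectory.\<close>

lemma kernel_observability_mat_iff:
  assumes C: "C \<in> carrier_mat k n" and A: "\<And>s. s < T \<Longrightarrow> A s \<in> carrier_mat n n"
  shows "mat_kernel (observability_mat n A C T) = {0\<^sub>v n} \<longleftrightarrow> observable n T A C"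
proof -
  note O = observability_mat_carrier[of C k n T A, OF C A]
  have ker: "mat_kernel (observability_mat n A C T) =
      {v \<in> carrier_vec n. \<forall>t\<le>T. C *\<^sub>v (transition_mat n A t *\<^sub>v v) = 0\<^sub>v k}"
    using observability_mat_mult_eq_0_iff[of C k n T A, OF C A] by (auto simp: mat_kernel[OF O])
  have P: "transition_mat n A t \<in> carrier_mat n n" if "t \<le> T" for t
    using A that by (intro transition_mat_carrier) auto
  show ?thesis
  proof
    assume triv: "mat_kernel (observability_mat n A C T) = {0\<^sub>v n}"
    show "observable n T A C"
      unfolding observable_def
    proof (intro allI impI, elim conjE)
      fix \<mu> \<nu> assume \<mu>: "trajectory n T A \<mu>" and \<nu>: "trajectory n T A \<nu>"
        and out: "\<forall>t\<le>T. C *\<^sub>v \<mu> t = C *\<^sub>v \<nu> t"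
      have car: "\<mu> 0 \<in> carrier_vec n" "\<nu> 0 \<in> carrier_vec n"
        using \<mu> \<nu> by (auto simp: trajectory_def)
      have "C *\<^sub>v (transition_mat n A t *\<^sub>v (\<mu> 0 - \<nu> 0)) = 0\<^sub>v k" if t: "t \<le> T" for t
      proof -
        have \<mu>t: "\<mu> t \<in> carrier_vec n" "\<nu> t \<in> carrier_vec n"
          using \<mu> \<nu> t by (auto simp: trajectory_def)
        have "transition_mat n A t *\<^sub>v (\<mu> 0 - \<nu> 0) = \<mu> t - \<nu> t"
          using mult_minus_distrib_mat_vec[OF P[OF t] car]
            trajectory_eq_transition_mat[OF \<mu> A t] trajectory_eq_transition_mat[OF \<nu> A t] by simp
        then have "C *\<^sub>v (transition_mat n A t *\<^sub>v (\<mu> 0 - \<nu> 0)) = C *\<^sub>v \<mu> t - C *\<^sub>v \<nu> t"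
          using mult_minus_distrib_mat_vec[OF C \<mu>t] by simp
        then show ?thesis using out t C \<mu>t by simp
      qed
      then have "\<mu> 0 - \<nu> 0 \<in> mat_kernel (observability_mat n A C T)"
        using car by (simp add: ker)
      then have zero: "\<mu> 0 - \<nu> 0 = 0\<^sub>v n" by (simp add: triv)
      show "\<mu> 0 = \<nu> 0"
      proof (rule eq_vecI)
        fix i assume "i < dim_vec (\<nu> 0)"
        then have "(\<mu> 0 - \<nu> 0) $ i = 0" using car by (simp add: zero)
        then show "\<mu> 0 $ i = \<nu> 0 $ i" using \<open>i < dim_vec (\<nu> 0)\<close> by simp
      qed (use car in simp)
    qed
  next
    assume obs: "observable n T A C"
    have "v = 0\<^sub>v n" if v: "v \<in> carrier_vec n"
      and out: "\<forall>t\<le>T. C *\<^sub>v (transition_mat n A t *\<^sub>v v) = 0\<^sub>v k" for v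
    proof -
      have "C *\<^sub>v (transition_mat n A t *\<^sub>v v) = C *\<^sub>v (transition_mat n A t *\<^sub>v 0\<^sub>v n)"
        if "t \<le> T" for t
        using out that mult_mat_zero_vec[OF P[OF that]] mult_mat_zero_vec[OF C] by simp
      then have "transition_mat n A 0 *\<^sub>v v = transition_mat n A 0 *\<^sub>v 0\<^sub>v n"
        using obs trajectory_transition_mat[of T A n, OF A] v zero_carrier_vec
        unfolding observable_def by blast
      then show ?thesis using v by simp
    qed
    moreover have "C *\<^sub>v (transition_mat n A t *\<^sub>v 0\<^sub>v n) = 0\<^sub>v k" if "t \<le> T" for t
      using mult_mat_zero_vec[OF P[OF that]] mult_mat_zero_vec[OF C] by simp
    ultimately show "mat_kernel (observability_mat n A C T) = {0\<^sub>v n}"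
      unfolding ker by auto
  qed
qed

text \<open>The form in which observability is applied, once for existence and once for uniqueness.
  The second application concerns a signed \<open>\<epsilon>\<close>, a rescaled difference of two
  states.\<close>

lemma observable_imp_zero:
  assumes "observable n T A (selection_mat n \<pi>)" "set \<pi> \<subseteq> {..<n}"
    and "\<And>t. t < T \<Longrightarrow> A t \<in> carrier_mat n n"
    and step: "\<And>t j. t < T \<Longrightarrow> j < n \<Longrightarrow> \<epsilon> (Suc t) j = (\<Sum>i<n. A t $$ (i, j) * \<epsilon> t i)"
    and out: "\<And>t l. t \<le> T \<Longrightarrow> l \<in> set \<pi> \<Longrightarrow> \<epsilon> t l = 0"
    and "t \<le> T" "i < n"
  shows "\<epsilon> t i = (0::real)"
proof -
  have "trajectory n T A (\<lambda>t. vec n (\<epsilon> t))"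
    unfolding trajectory_def
  proof (intro conjI allI impI)
    fix t assume "t < T"
    then show "vec n (\<epsilon> (Suc t)) = (A t)\<^sup>T *\<^sub>v vec n (\<epsilon> t)"
      using assms(3)[of t] step
      by (intro eq_vecI) (auto simp: scalar_prod_def atLeast0LessThan)
  qed simp
  moreover have "trajectory n T A (\<lambda>_. 0\<^sub>v n)"
    using assms(3) by (auto simp: trajectory_def mult_mat_zero_vec[where k = n and n = n])
  moreover have "selection_mat n \<pi> *\<^sub>v vec n (\<epsilon> t) = selection_mat n \<pi> *\<^sub>v 0\<^sub>v n" if "t \<le> T" for t
    using assms(2) out[OF that] by (subst selection_mat_mult_eq_iff) auto
  ultimately have "vec n (\<epsilon> 0) = 0\<^sub>v n"
    using assms(1) unfolding observable_def by blast
  then have zero: "\<epsilon> 0 i = 0" if "i < n" for i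
    using that by (metis index_vec index_zero_vec(1))
  show ?thesis
    using assms(6,7)
  proof (induction t arbitrary: i)
    case (Suc t)
    then show ?case by (simp add: step)
  qed (simp add: zero)
qed

section \<open>The hidden flow problem\<close>

locale hidden_flow =
  fixes n T :: nat and A :: "nat \<Rightarrow> real mat" and \<pi> :: "nat list"
    and \<rho> :: "nat \<Rightarrow> real vec" and M0 :: "nat \<Rightarrow> real mat"
  assumes T_pos: "1 \<le> T"
    and A: "\<And>t. t < T \<Longrightarrow> row_stochastic n (A t)"
    and \<pi>: "set \<pi> \<subseteq> {..<n}"
    and M0: "feasible n T A (selection_mat n \<pi>) \<rho> M0"
    and M0_pos: "\<And>t i j. t < T \<Longrightarrow> i < n \<Longrightarrow> j < n \<Longrightarrow> 0 < A t $$ (i, j) \<Longrightarrow> 0 < M0 t $$ (i, j)"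
begin

text \<open>Keeping only positive entries of \<open>A t\<close> builds the support condition into
  \<open>flow\<close>.\<close>

definition edges :: "(nat \<times> nat \<times> nat) set" where
  "edges = {(t, i, j). t < T \<and> i < n \<and> j < n \<and> 0 < A t $$ (i, j)}"

definition src :: "nat \<times> nat \<times> nat \<Rightarrow> nat \<times> nat" where
  "src = (\<lambda>(t, i, j). (t, i))"

definition weight :: "nat \<times> nat \<times> nat \<Rightarrow> real" where
  "weight = (\<lambda>(t, i, j). A t $$ (i, j))"

definition of_mats :: "(nat \<Rightarrow> real mat) \<Rightarrow> nat \<times> nat \<times> nat \<Rightarrow> real" where
  "of_mats M = (\<lambda>(t, i, j). if t < T \<and> i < n \<and> j < n then M t $$ (i, j) else 0)"

definition to_mats :: "(nat \<times> nat \<times> nat \<Rightarrow> real) \<Rightarrow> nat \<Rightarrow> real mat" where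
  "to_mats x = (\<lambda>t\<in>{..<T}. mat n n (\<lambda>(i, j). x (t, i, j)))"

text \<open>
  \<open>Inl (t, l)\<close> fixes the observed mass of state \<open>l\<close> at time \<open>t\<close>, and \<open>Inr (t, l)\<close> is
  conservation of mass in state \<open>l\<close> between steps \<open>t - 1\<close> and \<open>t\<close>. There is no outgoing edge
  at time \<open>T\<close>, where the observed mass is incoming.
\<close>

definition constraints :: "(nat \<times> nat + nat \<times> nat) set" where
  "constraints = ({..T} \<times> set \<pi>) <+> ({1..<T} \<times> {..<n})"

text \<open>On \<open>Inr\<close> this is the signed incidence matrix of the time-expanded graph,
  whose edge \<open>(t, i, j)\<close> runs from \<open>(t, i)\<close> to \<open>(Suc t, j)\<close>.
  The second summand on \<open>Inl\<close> reads targets, and only in the last step.\<close>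

definition coeff :: "nat \<times> nat + nat \<times> nat \<Rightarrow> nat \<times> nat \<times> nat \<Rightarrow> real" where
  "coeff k = (\<lambda>(t, i, j). case k of
      Inl p \<Rightarrow> of_bool (p = (t, i)) + of_bool (Suc t = T) * of_bool (p = (Suc t, j))
    | Inr p \<Rightarrow> of_bool (p = (t, i)) - of_bool (p = (Suc t, j)))"

lemma A_carrier: "t < T \<Longrightarrow> A t \<in> carrier_mat n n"
  and A_nonneg: "t < T \<Longrightarrow> i < n \<Longrightarrow> j < n \<Longrightarrow> 0 \<le> A t $$ (i, j)"
  using A[of t] by (auto simp: row_stochastic_def nonneg_matrix_def)

lemma A_row: "t < T \<Longrightarrow> i < n \<Longrightarrow> (\<Sum>j<n. A t $$ (i, j)) = 1"
proof -
  assume t: "t < T" and i: "i < n"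
  have "vec n (\<lambda>i. \<Sum>j<n. A t $$ (i, j)) = ones_vec n"
    using A[OF t] mult_mat_ones_vec(1)[OF A_carrier[OF t]] by (simp add: row_stochastic_def)
  then have "vec n (\<lambda>i. \<Sum>j<n. A t $$ (i, j)) $ i = ones_vec n $ i" by simp
  then show ?thesis using i by (simp add: ones_vec_def)
qed

lemma finite_edges: "finite edges"
  by (rule finite_subset[of _ "{..<T} \<times> {..<n} \<times> {..<n}"]) (auto simp: edges_def)

lemma sum_row:
  assumes "\<forall>e. e \<notin> edges \<longrightarrow> x e = 0"
  shows "sum x {e \<in> edges. src e = (t, l)} = (\<Sum>j<n. x (t, l, j) :: real)"
proof -
  have "(\<Sum>j<n. x (t, l, j)) = sum x ((\<lambda>j. (t, l, j)) ` {..<n})"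
    by (subst sum.reindex) (auto simp: inj_on_def)
  also have "\<dots> = sum x {e \<in> edges. src e = (t, l)}"
    using finite_edges assms by (intro sum.mono_neutral_cong) (auto simp: src_def edges_def)
  finally show ?thesis ..
qed

lemma sum_edges_from:
  assumes "\<forall>e. e \<notin> edges \<longrightarrow> x e = 0"
  shows "(\<Sum>e\<in>edges. of_bool ((t, l) = src e) * x e) = (\<Sum>j<n. x (t, l, j) :: real)"
proof -
  have "(\<Sum>j<n. x (t, l, j)) = sum x ((\<lambda>j. (t, l, j)) ` {..<n})"
    by (subst sum.reindex) (auto simp: inj_on_def)
  also have "\<dots> = (\<Sum>e\<in>edges. of_bool ((t, l) = src e) * x e)"
    using finite_edges assms by (intro sum.mono_neutral_cong) (auto simp: src_def edges_def)
  finally show ?thesis ..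
qed

lemma sum_edges_to:
  assumes "\<forall>e. e \<notin> edges \<longrightarrow> x e = 0"
  shows "(\<Sum>e\<in>edges. of_bool ((t, l) = (case e of (s, i, j) \<Rightarrow> (s, j))) * x e) =
    (\<Sum>i<n. x (t, i, l) :: real)"
proof -
  have "(\<Sum>i<n. x (t, i, l)) = sum x ((\<lambda>i. (t, i, l)) ` {..<n})"
    by (subst sum.reindex) (auto simp: inj_on_def)
  also have "\<dots> = (\<Sum>e\<in>edges. of_bool ((t, l) = (case e of (s, i, j) \<Rightarrow> (s, j))) * x e)"
    using finite_edges assms by (intro sum.mono_neutral_cong) (auto simp: edges_def)
  finally show ?thesis ..
qed

lemma weight_row:
  assumes "e \<in> edges"
  shows "sum weight {e' \<in> edges. src e' = src e} = 1"
proof -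
  obtain t i j where e: "e = (t, i, j)" "t < T" "i < n"
    using assms by (auto simp: edges_def)
  let ?w = "\<lambda>e. if e \<in> edges then weight e else 0"
  have "sum weight {e' \<in> edges. src e' = src e} = sum ?w {e' \<in> edges. src e' = (t, i)}"
    by (intro sum.cong) (auto simp: e src_def)
  also have "\<dots> = (\<Sum>j<n. ?w (t, i, j))"
    by (rule sum_row) simp
  also have "\<dots> = (\<Sum>j<n. A t $$ (i, j))"
    using e A_nonneg[of t i] by (intro sum.cong) (force simp: edges_def weight_def)+
  finally show ?thesis using A_row e by simp
qed

sublocale entropy_program edges src weight constraints coeff "of_mats M0"
proof
  show "finite constraints" by (simp add: constraints_def)
  show "0 < weight e" "0 < of_mats M0 e" if "e \<in> edges" for e
    using that M0_pos by (auto simp: edges_def weight_def of_mats_def)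
  show "of_mats M0 e = 0" if "e \<notin> edges" for e
  proof (rule ccontr)
    assume nz: "of_mats M0 e \<noteq> 0"
    obtain t i j where e: "e = (t, i, j)" by (cases e) auto
    with nz have t: "t < T" "i < n" "j < n" "M0 t $$ (i, j) \<noteq> 0"
      by (auto simp: of_mats_def split: if_splits)
    moreover have "M0 t \<in> carrier_mat n n" "mat_supp (M0 t) \<subseteq> mat_supp (A t)"
      using M0 t by (auto simp: feasible_def)
    ultimately have "(i, j) \<in> mat_supp (A t)" by (auto simp: mat_supp_def)
    then have "A t $$ (i, j) \<noteq> 0" by (auto simp: mat_supp_def)
    with A_nonneg[of t i j] t that show False by (auto simp: e edges_def)
  qed
qed (rule finite_edges, rule weight_row)

text \<open>The marginal at time \<open>t\<close>: outgoing mass while there is a next step,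
  incoming mass at the final time.\<close>

definition state :: "(nat \<times> nat \<times> nat \<Rightarrow> real) \<Rightarrow> nat \<Rightarrow> nat \<Rightarrow> real" where
  "state x t i = (if t < T then \<Sum>j<n. x (t, i, j) else \<Sum>j<n. x (T - 1, j, i))"

lemma mass_eq_state:
  assumes "\<forall>e. e \<notin> edges \<longrightarrow> x e = 0" "t < T"
  shows "mass x (t, i) = state x t i"
  unfolding mass_def using sum_row[of x t i, OF assms(1)] assms(2) by (simp add: state_def)

lemma lin_observation:
  assumes "\<forall>e. e \<notin> edges \<longrightarrow> x e = 0" "t \<le> T"
  shows "lin (Inl (t, l)) x = state x t l"
proof (cases "t < T")
  case True
  then have "lin (Inl (t, l)) x = (\<Sum>e\<in>edges. of_bool ((t, l) = src e) * x e)"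
    unfolding lin_def by (intro sum.cong) (auto simp: coeff_def src_def of_bool_def split: if_splits)
  also have "\<dots> = (\<Sum>j<n. x (t, l, j))"
    by (rule sum_edges_from[OF assms(1)])
  finally show ?thesis using True by (simp add: state_def)
next
  case False
  then have t: "t = T" using assms(2) by simp
  have "lin (Inl (t, l)) x =
      (\<Sum>e\<in>edges. of_bool ((T - 1, l) = (case e of (s, i, j) \<Rightarrow> (s, j))) * x e)"
    unfolding lin_def t using T_pos by (intro sum.cong) (auto simp: coeff_def edges_def)
  also have "\<dots> = (\<Sum>i<n. x (T - 1, i, l))"
    by (rule sum_edges_to[OF assms(1)])
  finally show ?thesis by (simp add: state_def t)
qed

lemma lin_conservation:
  assumes "\<forall>e. e \<notin> edges \<longrightarrow> x e = 0" "1 \<le> t" "t < T"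
  shows "lin (Inr (t, l)) x = state x t l - (\<Sum>i<n. x (t - 1, i, l))"
proof -
  have "lin (Inr (t, l)) x = (\<Sum>e\<in>edges. of_bool ((t, l) = src e) * x e -
      of_bool ((t - 1, l) = (case e of (s, i, j) \<Rightarrow> (s, j))) * x e)"
    unfolding lin_def using assms(2)
    by (intro sum.cong) (auto simp: coeff_def src_def left_diff_distrib)
  also have "\<dots> = (\<Sum>j<n. x (t, l, j)) - (\<Sum>i<n. x (t - 1, i, l))"
    unfolding sum_subtractf
    by (intro arg_cong2[of _ _ _ _ minus] sum_edges_from sum_edges_to assms(1))
  finally show ?thesis using assms(3) by (simp add: state_def)
qed

text \<open>Conservation is imposed only at times \<open>1, ..., T - 1\<close>; for the last
  transition, into time \<open>T\<close>, the identity is the definition of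
  \<open>state\<close>.\<close>

lemma state_Suc_iff:
  assumes "\<forall>e. e \<notin> edges \<longrightarrow> x e = 0"
  shows "(\<forall>t l. 1 \<le> t \<and> t < T \<and> l < n \<longrightarrow> lin (Inr (t, l)) x = 0) \<longleftrightarrow>
    (\<forall>t<T. \<forall>l<n. state x (Suc t) l = (\<Sum>i<n. x (t, i, l)))" (is "?L \<longleftrightarrow> ?R")
proof
  assume L: ?L
  show ?R
  proof (intro allI impI)
    fix t l assume t: "t < T" and l: "l < n"
    show "state x (Suc t) l = (\<Sum>i<n. x (t, i, l))"
    proof (cases "Suc t < T")
      case True
      then show ?thesis using L lin_conservation[of x "Suc t" l, OF assms] l by force
    next
      case False
      then have "Suc t = T" using t by simp
      then show ?thesis unfolding state_def by auto
    qed
  qed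
next
  assume R: ?R
  show ?L
  proof (intro allI impI)
    fix t l assume t: "1 \<le> t \<and> t < T \<and> l < n"
    then obtain s where "t = Suc s" by (cases t) auto
    then show "lin (Inr (t, l)) x = 0"
      using R lin_conservation[of x t l, OF assms] t by auto
  qed
qed

lemma all_constraints_iff:
  "(\<forall>k\<in>constraints. P k) \<longleftrightarrow> (\<forall>t\<le>T. \<forall>l\<in>set \<pi>. P (Inl (t, l))) \<and>
    (\<forall>t l. 1 \<le> t \<and> t < T \<and> l < n \<longrightarrow> P (Inr (t, l)))"
  unfolding constraints_def by (auto simp: Plus_def)

section \<open>Translation between matrix families and flows\<close>

lemma flow_off: "flow x \<Longrightarrow> \<forall>e. e \<notin> edges \<longrightarrow> x e = 0"
  unfolding flow_def by blast

lemma to_mats_carrier: "to_mats x \<in> {..<T} \<rightarrow>\<^sub>E carrier_mat n n"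
  by (auto simp: to_mats_def)

lemma of_mats_to_mats: "flow x \<Longrightarrow> of_mats (to_mats x) = x"
proof
  fix e :: "nat \<times> nat \<times> nat"
  assume x: "flow x"
  obtain t i j where e: "e = (t, i, j)" by (cases e) auto
  show "of_mats (to_mats x) e = x e"
    using flow_off[OF x] by (auto simp: e of_mats_def to_mats_def edges_def)
qed

lemma to_mats_of_mats:
  assumes "M \<in> {..<T} \<rightarrow>\<^sub>E carrier_mat n n"
  shows "to_mats (of_mats M) = M"
proof
  fix t
  show "to_mats (of_mats M) t = M t"
  proof (cases "t < T")
    case True
    then have "M t \<in> carrier_mat n n" using assms by auto
    with True show ?thesis by (auto simp: to_mats_def of_mats_def intro!: eq_matI)
  next
    case False
    then show ?thesis using PiE_arb[OF assms, of t] by (simp add: to_mats_def)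
  qed
qed

lemma mats_mult_ones_vec:
  assumes "M \<in> {..<T} \<rightarrow>\<^sub>E carrier_mat n n" "t < T"
  shows "M t *\<^sub>v ones_vec n = vec n (state (of_mats M) t)"
    and "(M t)\<^sup>T *\<^sub>v ones_vec n = vec n (\<lambda>l. \<Sum>i<n. of_mats M (t, i, l))"
proof -
  have "M t \<in> carrier_mat n n" using assms by auto
  then show "M t *\<^sub>v ones_vec n = vec n (state (of_mats M) t)"
    and "(M t)\<^sup>T *\<^sub>v ones_vec n = vec n (\<lambda>l. \<Sum>i<n. of_mats M (t, i, l))"
    using assms(2) by (auto simp: mult_mat_ones_vec state_def of_mats_def intro!: eq_vecI)
qed

lemma final_state:
  assumes "M \<in> {..<T} \<rightarrow>\<^sub>E carrier_mat n n"
  shows "(M (T - 1))\<^sup>T *\<^sub>v ones_vec n = vec n (state (of_mats M) T)"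
proof -
  have "state (of_mats M) T = (\<lambda>l. \<Sum>i<n. of_mats M (T - 1, i, l))"
    by (rule ext) (simp add: state_def)
  then show ?thesis
    using mats_mult_ones_vec(2)[OF assms, of "T - 1"] T_pos by simp
qed

lemma flow_of_mats_iff:
  assumes "M \<in> {..<T} \<rightarrow>\<^sub>E carrier_mat n n"
  shows "(\<forall>t<T. nonneg_matrix (M t) \<and> mat_supp (M t) \<subseteq> mat_supp (A t)) \<longleftrightarrow> flow (of_mats M)"
proof -
  have "nonneg_matrix (M t) \<longleftrightarrow> (\<forall>i<n. \<forall>j<n. 0 \<le> M t $$ (i, j))"
    and "mat_supp (M t) \<subseteq> mat_supp (A t) \<longleftrightarrow>
      (\<forall>i<n. \<forall>j<n. M t $$ (i, j) \<noteq> 0 \<longrightarrow> 0 < A t $$ (i, j))" if t: "t < T" for t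
  proof -
    have M: "M t \<in> carrier_mat n n" using assms t by auto
    then show "nonneg_matrix (M t) \<longleftrightarrow> (\<forall>i<n. \<forall>j<n. 0 \<le> M t $$ (i, j))"
      by (simp add: nonneg_matrix_def)
    have "A t $$ (i, j) \<noteq> 0 \<longleftrightarrow> 0 < A t $$ (i, j)" if "i < n" "j < n" for i j
      using A_nonneg[OF t that] by auto
    then show "mat_supp (M t) \<subseteq> mat_supp (A t) \<longleftrightarrow>
        (\<forall>i<n. \<forall>j<n. M t $$ (i, j) \<noteq> 0 \<longrightarrow> 0 < A t $$ (i, j))"
      using M A_carrier[OF t] by (auto simp: mat_supp_def)
  qed
  moreover have "flow (of_mats M) \<longleftrightarrow> (\<forall>t<T. \<forall>i<n. \<forall>j<n. 0 \<le> M t $$ (i, j) \<and>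
      (M t $$ (i, j) \<noteq> 0 \<longrightarrow> 0 < A t $$ (i, j)))"
    unfolding flow_def split_paired_All by (auto simp: of_mats_def edges_def) metis
  ultimately show ?thesis by auto
qed

lemma M0_carrier: "M0 \<in> {..<T} \<rightarrow>\<^sub>E carrier_mat n n"
  using M0 by (simp add: feasible_def)

text \<open>\<open>M0\<close> meets the constraints, so \<open>\<rho> t\<close> is the observed part
  of its own state. This eliminates \<open>\<rho>\<close> and produces right-hand sides of the form
  \<open>lin k r\<close>.\<close>

lemma observation_iff:
  assumes "M \<in> {..<T} \<rightarrow>\<^sub>E carrier_mat n n"
  shows "(\<forall>t<T. selection_mat n \<pi> *\<^sub>v (M t *\<^sub>v ones_vec n) = \<rho> t) \<and>
      selection_mat n \<pi> *\<^sub>v ((M (T - 1))\<^sup>T *\<^sub>v ones_vec n) = \<rho> T \<longleftrightarrow>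
    (\<forall>t\<le>T. \<forall>l\<in>set \<pi>. state (of_mats M) t l = state (of_mats M0) t l)"
proof -
  have split: "(\<forall>t<T. selection_mat n \<pi> *\<^sub>v (M t *\<^sub>v ones_vec n) = \<rho> t) \<and>
      selection_mat n \<pi> *\<^sub>v ((M (T - 1))\<^sup>T *\<^sub>v ones_vec n) = \<rho> T \<longleftrightarrow>
    (\<forall>t\<le>T. selection_mat n \<pi> *\<^sub>v vec n (state (of_mats M) t) = \<rho> t)"
    if M: "M \<in> {..<T} \<rightarrow>\<^sub>E carrier_mat n n" for M
    using mats_mult_ones_vec(1)[OF M] final_state[OF M] by (auto simp: le_less)
  have "\<forall>t\<le>T. selection_mat n \<pi> *\<^sub>v vec n (state (of_mats M0) t) = \<rho> t"
    using M0 unfolding split[OF M0_carrier, symmetric] by (simp add: feasible_def)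
  then have "\<rho> t = selection_mat n \<pi> *\<^sub>v vec n (state (of_mats M0) t)" if "t \<le> T" for t
    using that by simp
  moreover have "selection_mat n \<pi> *\<^sub>v vec n v = selection_mat n \<pi> *\<^sub>v vec n w \<longleftrightarrow>
      (\<forall>l\<in>set \<pi>. v l = w l)" for v w :: "nat \<Rightarrow> real"
  proof -
    have "l < n" if "l \<in> set \<pi>" for l using \<pi> that by auto
    then show ?thesis by (simp add: selection_mat_mult_eq_iff[OF \<pi>])
  qed
  ultimately show ?thesis
    unfolding split[OF assms] by simp
qed

lemma conservation_iff:
  assumes "M \<in> {..<T} \<rightarrow>\<^sub>E carrier_mat n n" "flow (of_mats M)"
  shows "(\<forall>t. 1 \<le> t \<and> t < T \<longrightarrow> M t *\<^sub>v ones_vec n = (M (t - 1))\<^sup>T *\<^sub>v ones_vec n) \<longleftrightarrow>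
    (\<forall>t l. 1 \<le> t \<and> t < T \<and> l < n \<longrightarrow> lin (Inr (t, l)) (of_mats M) = 0)"
proof -
  have "M t *\<^sub>v ones_vec n = (M (t - 1))\<^sup>T *\<^sub>v ones_vec n \<longleftrightarrow>
      (\<forall>l<n. lin (Inr (t, l)) (of_mats M) = 0)" if t: "1 \<le> t" "t < T" for t
  proof -
    have "t - 1 < T" using t by simp
    then show ?thesis
      unfolding mats_mult_ones_vec(1)[OF assms(1) t(2)] mats_mult_ones_vec(2)[OF assms(1) \<open>t - 1 < T\<close>]
        lin_conservation[OF flow_off[OF assms(2)] t]
      by (simp add: vec_eq_iff)
  qed
  then show ?thesis by blast
qed

lemma feasible_iff_admissible:
  assumes M: "M \<in> {..<T} \<rightarrow>\<^sub>E carrier_mat n n"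
  shows "feasible n T A (selection_mat n \<pi>) \<rho> M \<longleftrightarrow> admissible (of_mats M)"
proof -
  have r: "flow (of_mats M0)"
    using admissible_r by (simp add: admissible_def)
  have r0: "\<forall>t l. 1 \<le> t \<and> t < T \<and> l < n \<longrightarrow> lin (Inr (t, l)) (of_mats M0) = 0"
    using M0 unfolding conservation_iff[OF M0_carrier r, symmetric] by (simp add: feasible_def)
  have "admissible (of_mats M) \<longleftrightarrow> flow (of_mats M) \<and>
      (\<forall>t\<le>T. \<forall>l\<in>set \<pi>. state (of_mats M) t l = state (of_mats M0) t l) \<and>
      (\<forall>t l. 1 \<le> t \<and> t < T \<and> l < n \<longrightarrow> lin (Inr (t, l)) (of_mats M) = 0)"
    unfolding admissible_def all_constraints_iff
    using lin_observation[OF flow_off] r r0 by auto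
  then show ?thesis
    unfolding feasible_def
    using M flow_of_mats_iff[OF M] observation_iff[OF M] conservation_iff[OF M] by blast
qed

lemma cost_eq_objective:
  assumes M: "M \<in> {..<T} \<rightarrow>\<^sub>E carrier_mat n n" and flow: "flow (of_mats M)"
  shows "cost n T A M = objective weight (of_mats M)"
proof -
  let ?x = "of_mats M"
  let ?F = "\<lambda>(t, i, j). kl_term (?x (t, i, j)) (A t $$ (i, j) * state ?x t i)"
  have kl: "kl_div (M t) (mat_diag n (\<lambda>i. (M t *\<^sub>v ones_vec n) $ i) * A t) =
      (\<Sum>i<n. \<Sum>j<n. ?F (t, i, j))" if t: "t < T" for t
  proof -
    have "M t \<in> carrier_mat n n" using M t by auto
    then show ?thesis
      unfolding kl_div_def mats_mult_ones_vec(1)[OF M t] mat_diag_mult_left[OF A_carrier[OF t]]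
      using t by (intro sum.cong) (auto simp: kl_term_def of_mats_def mult.commute)
  qed
  have "cost n T A M = sum ?F ({..<T} \<times> {..<n} \<times> {..<n})"
    by (simp add: cost_def kl sum.cartesian_product)
  also have "\<dots> = (\<Sum>e\<in>edges. kl_term (?x e) (weight e * mass ?x (src e)))"
  proof (rule sum.mono_neutral_cong_right)
    show "\<forall>e\<in>{..<T} \<times> {..<n} \<times> {..<n} - edges. ?F e = 0"
    proof
      fix e assume e: "e \<in> {..<T} \<times> {..<n} \<times> {..<n} - edges"
      obtain t i j where [simp]: "e = (t, i, j)" by (cases e) auto
      have "A t $$ (i, j) = 0" using e A_nonneg[of t i j] by (auto simp: edges_def)
      moreover have "?x (t, i, j) = 0" using flow_off[OF flow] e by simp
      ultimately show "?F e = 0" by (simp add: kl_term_def)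
    qed
    show "?F e = kl_term (?x e) (weight e * mass ?x (src e))" if "e \<in> edges" for e
      using that mass_eq_state[OF flow_off[OF flow]] by (auto simp: edges_def weight_def src_def)
  qed (auto simp: edges_def)
  finally show ?thesis by (simp add: objective_def)
qed

lemma optimizer_iff_optimal:
  "optimizer n T A (selection_mat n \<pi>) \<rho> M \<longleftrightarrow>
    M \<in> {..<T} \<rightarrow>\<^sub>E carrier_mat n n \<and> optimal (of_mats M)"
proof -
  have feas: "M \<in> {..<T} \<rightarrow>\<^sub>E carrier_mat n n" if "feasible n T A (selection_mat n \<pi>) \<rho> M" for M
    using that by (simp add: feasible_def)
  have flow: "flow x" if "admissible x" for x
    using that by (simp add: admissible_def)
  have all: "(\<forall>N. feasible n T A (selection_mat n \<pi>) \<rho> N \<longrightarrow> P (cost n T A N)) \<longleftrightarrow>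
      (\<forall>y. admissible y \<longrightarrow> P (objective weight y))" for P
    by (metis feas flow feasible_iff_admissible cost_eq_objective of_mats_to_mats to_mats_carrier)
  have "optimizer n T A (selection_mat n \<pi>) \<rho> M \<longleftrightarrow> feasible n T A (selection_mat n \<pi>) \<rho> M \<and>
      (\<forall>N. feasible n T A (selection_mat n \<pi>) \<rho> N \<longrightarrow> cost n T A M \<le> cost n T A N)"
    by (auto simp: optimizer_def is_arg_min_def not_less)
  then show ?thesis
    unfolding all optimal_def
    using feas feasible_iff_admissible cost_eq_objective flow by metis
qed

section \<open>Consequences of observability for existence and uniqueness\<close>

lemma recession_direction_zero:
  assumes "observable n T A (selection_mat n \<pi>)"
    and flow: "flow d" and lin: "\<forall>k\<in>constraints. lin k d = 0"
    and d: "\<forall>e\<in>edges. d e = weight e * mass d (src e)"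
  shows "\<forall>e\<in>edges. d e = 0"
proof -
  have off: "\<forall>e. e \<notin> edges \<longrightarrow> d e = 0" by (rule flow_off[OF flow])
  \<comment> \<open>A flow with kernel \<open>weight\<close> that conserves mass moves its states by
    the transposes of \<open>A t\<close>; off the edges both sides of the entrywise identity
    vanish.\<close>
  have step: "state d (Suc t) j = (\<Sum>i<n. A t $$ (i, j) * state d t i)" if tj: "t < T" "j < n" for t j
  proof -
    have "d (t, i, j) = A t $$ (i, j) * state d t i" if i: "i < n" for i
    proof (cases "(t, i, j) \<in> edges")
      case True
      then show ?thesis
        using d mass_eq_state[of d t i, OF off \<open>t < T\<close>] by (auto simp: weight_def src_def)
    next
      case False
      then have "A t $$ (i, j) = 0"
        using A_nonneg[of t i j] i tj by (auto simp: edges_def)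
      then show ?thesis using off False by simp
    qed
    moreover have "state d (Suc t) j = (\<Sum>i<n. d (t, i, j))"
      using state_Suc_iff[of d, OF off] lin tj unfolding all_constraints_iff by blast
    ultimately show ?thesis by simp
  qed
  have "state d t l = 0" if "t \<le> T" "l \<in> set \<pi>" for t l
    using lin lin_observation[of d t l, OF off that(1)] that unfolding all_constraints_iff by auto
  then have "state d t i = 0" if "t \<le> T" "i < n" for t i
    using observable_imp_zero[OF assms(1) \<pi> A_carrier, of "state d"] step that by blast
  then have "mass d (src e) = 0" if "e \<in> edges" for e
    using that mass_eq_state[of d, OF off] by (auto simp: edges_def src_def)
  then show ?thesis using d by simp
qed

text \<open>An edge meets few constraints: observation and conservation at its source, and at its
  target either conservation or the final observation. Writing the target part as one subtracted
  term prepares a potential difference, hence the double sign on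
  \<open>c (Inl (T, j))\<close>.\<close>

lemma sum_constraints:
  assumes "(t, i, j) \<in> edges"
  shows "(\<Sum>k\<in>constraints. c k * coeff k (t, i, j)) =
    (if i \<in> set \<pi> then c (Inl (t, i)) else 0) + (if 1 \<le> t then c (Inr (t, i)) else 0)
    - (if Suc t < T then c (Inr (Suc t, j)) else if j \<in> set \<pi> then - c (Inl (T, j)) else 0)"
proof -
  have t: "t < T" "i < n" "j < n" using assms by (auto simp: edges_def)
  have delta: "(\<Sum>p\<in>S. f p * of_bool (p = q)) = (if q \<in> S then f q else 0)"
    if "finite S" for S and f :: "nat \<times> nat \<Rightarrow> real" and q
    using that by (simp add: of_bool_def if_distrib cong: if_cong)
  let ?O = "{..T} \<times> set \<pi>" and ?F = "{1..<T} \<times> {..<n}"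
  have "(\<Sum>k\<in>constraints. c k * coeff k (t, i, j)) =
      (\<Sum>p\<in>?O. c (Inl p) * coeff (Inl p) (t, i, j)) + (\<Sum>p\<in>?F. c (Inr p) * coeff (Inr p) (t, i, j))"
    unfolding constraints_def by (subst sum.Plus) auto
  also have "(\<Sum>p\<in>?O. c (Inl p) * coeff (Inl p) (t, i, j)) =
      (\<Sum>p\<in>?O. c (Inl p) * of_bool (p = (t, i))) +
      of_bool (Suc t = T) * (\<Sum>p\<in>?O. c (Inl p) * of_bool (p = (Suc t, j)))"
    unfolding sum_distrib_left sum.distrib[symmetric]
    by (intro sum.cong) (auto simp: coeff_def algebra_simps)
  also have "(\<Sum>p\<in>?F. c (Inr p) * coeff (Inr p) (t, i, j)) =
      (\<Sum>p\<in>?F. c (Inr p) * of_bool (p = (t, i))) - (\<Sum>p\<in>?F. c (Inr p) * of_bool (p = (Suc t, j)))"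
    unfolding sum_subtractf[symmetric] by (intro sum.cong) (auto simp: coeff_def algebra_simps)
  finally show ?thesis
    using t by (cases "Suc t = T") (auto simp: delta)
qed

text \<open>
  The multipliers of the observations before time \<open>T\<close> are invisible to the difference of two
  optimizers, because their observed masses agree. Those of mass conservation, with the multipliers
  of the last observation at time \<open>T\<close>, form a potential \<open>\<alpha>\<close>, and rescaling the difference of
  states by \<open>exp \<alpha>\<close> turns it into a trajectory of the original system.
\<close>

lemma optimal_unique:
  assumes obs: "observable n T A (selection_mat n \<pi>)" and x: "optimal x" and y: "optimal y"
  shows "x = y"
proof -
  have flow: "flow x" "flow y" and lin: "\<forall>k\<in>constraints. lin k x = lin k y"
    using x y by (auto simp: optimal_def admissible_def)
  obtain c where c: "\<And>e. e \<in> edges \<Longrightarrow> x e - y e =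
      (mass x (src e) - mass y (src e)) * (weight e * exp (\<Sum>k\<in>constraints. c k * coeff k e))"
    using optimal_difference[OF x y] by blast
  define d where "d = (\<lambda>e. x e - y e)"
  have off: "\<forall>e. e \<notin> edges \<longrightarrow> d e = 0"
    using flow_off[OF flow(1)] flow_off[OF flow(2)] unfolding d_def by fastforce
  have "lin k d = lin k x - lin k y" for k
    using lin_affine[of k 1 x "-1" y] by (simp add: d_def)
  then have lin_d: "\<forall>k\<in>constraints. lin k d = 0"
    using lin by simp
  have mass_d: "mass d v = mass x v - mass y v" for v
    using mass_affine[of 1 x "-1" y v] by (simp add: d_def)
  have d_c: "d e = mass d (src e) * (weight e * exp (\<Sum>k\<in>constraints. c k * coeff k e))"
    if "e \<in> edges" for e
    unfolding mass_d c[OF that, symmetric] by (simp add: d_def)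
  have observed: "state d t l = 0" if "t \<le> T" "l \<in> set \<pi>" for t l
    using lin_d lin_observation[of d t l, OF off that(1)] that unfolding all_constraints_iff by auto
  \<comment> \<open>Time 0 has no conservation multiplier, so the potential starts at 0. At time
    \<open>T\<close> the sign flips because the final observation counts incoming mass with
    \<open>+1\<close>, conservation with \<open>-1\<close>.\<close>
  define \<alpha> where "\<alpha> t i = (if t = 0 then 0 else if t < T then c (Inr (t, i))
      else if i \<in> set \<pi> then - c (Inl (T, i)) else 0)" for t i
  have d_eq: "d (t, i, j) * exp (\<alpha> (Suc t) j) = A t $$ (i, j) * (state d t i * exp (\<alpha> t i))"
    if tij: "t < T" "i < n" "j < n" for t i j
  proof (cases "(t, i, j) \<in> edges")
    case True
    let ?l = "if i \<in> set \<pi> then c (Inl (t, i)) else 0"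
    have "(\<Sum>k\<in>constraints. c k * coeff k (t, i, j)) = ?l + \<alpha> t i - \<alpha> (Suc t) j"
      using sum_constraints[OF True, of c] tij by (auto simp: \<alpha>_def)
    moreover have "d (t, i, j) = state d t i *
        (A t $$ (i, j) * exp (\<Sum>k\<in>constraints. c k * coeff k (t, i, j)))"
      using d_c[OF True] mass_eq_state[OF off tij(1), of i] by (simp add: src_def weight_def)
    ultimately have "d (t, i, j) * exp (\<alpha> (Suc t) j) =
        state d t i * exp ?l * (A t $$ (i, j) * exp (\<alpha> t i))"
      by (simp add: exp_add exp_diff)
    \<comment> \<open>Either \<open>i\<close> is observed and the state of \<open>d\<close> is 0
      there, or \<open>?l\<close> is 0.\<close>
    also have "state d t i * exp ?l = state d t i"
      using observed[of t i] tij by auto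
    finally show ?thesis by simp
  next
    case False
    then have "A t $$ (i, j) = 0"
      using A_nonneg[OF tij] tij by (auto simp: edges_def)
    then show ?thesis using off False by simp
  qed
  have "state d t i * exp (\<alpha> t i) = 0" if "t \<le> T" "i < n" for t i
  proof (rule observable_imp_zero[OF obs \<pi> A_carrier _ _ that])
    fix t j assume t: "t < T" and j: "j < n"
    have "state d (Suc t) j = (\<Sum>i<n. d (t, i, j))"
      using state_Suc_iff[of d, OF off] lin_d t j unfolding all_constraints_iff by blast
    then show "state d (Suc t) j * exp (\<alpha> (Suc t) j) =
        (\<Sum>i<n. A t $$ (i, j) * (state d t i * exp (\<alpha> t i)))"
      using d_eq t j by (simp add: sum_distrib_right)
  qed (use observed in auto)
  then have state_0: "state d t i = 0" if "t < T" "i < n" for t i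
    using that by (metis exp_not_eq_zero less_imp_le mult_eq_0_iff)
  have "d e = 0" for e
  proof (cases "e \<in> edges")
    case True
    obtain t i j where e: "e = (t, i, j)" by (cases e) auto
    then have "t < T" "i < n" "j < n" using True by (auto simp: edges_def)
    then show ?thesis using d_eq[of t i j] state_0 by (simp add: e)
  qed (use off in blast)
  then show ?thesis by (auto simp: d_def)
qed

lemma ex1_optimizer:
  assumes "observable n T A (selection_mat n \<pi>)"
  shows "\<exists>!M. optimizer n T A (selection_mat n \<pi>) \<rho> M"
proof -
  obtain x where x: "optimal x"
    using ex_optimal recession_direction_zero[OF assms] by blast
  then have "flow x" by (simp add: optimal_def admissible_def)
  then have "optimizer n T A (selection_mat n \<pi>) \<rho> (to_mats x)"
    using x by (simp add: optimizer_iff_optimal to_mats_carrier of_mats_to_mats)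
  moreover have "M = to_mats x" if "optimizer n T A (selection_mat n \<pi>) \<rho> M" for M
    using that optimal_unique[OF assms x, of "of_mats M"] to_mats_of_mats[of M]
    by (simp add: optimizer_iff_optimal)
  ultimately show ?thesis by blast
qed

end

theorem corollary1:
  fixes n T k :: nat
    and A :: "nat \<Rightarrow> real mat"
    and \<pi> :: "nat list"
    and C :: "real mat"
    and \<rho> :: "nat \<Rightarrow> real Matrix.vec"
  assumes "1 \<le> n" and "1 \<le> T"
    and "\<And>t. t < T \<Longrightarrow> row_stochastic n (A t)"
    and "distinct \<pi>" and "set \<pi> \<subseteq> {..<n}" and "length \<pi> = k"
    and "C = selection_mat n \<pi>"
    and "\<And>t. t \<le> T \<Longrightarrow> \<rho> t \<in> carrier_vec k"
    and "\<exists>M. feasible n T A C \<rho> M \<and>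
           (\<forall>t<T. \<forall>i<n. \<forall>j<n. 0 < A t $$ (i, j) \<longrightarrow> 0 < M t $$ (i, j))"
  shows "(mat_kernel (observability_mat n A C T) = {0\<^sub>v n} \<longleftrightarrow> observable n T A C) \<and>
         (mat_kernel (observability_mat n A C T) = {0\<^sub>v n} \<longrightarrow>
            (\<exists>!M. optimizer n T A C \<rho> M))"
proof -
  obtain M0 where M0: "feasible n T A (selection_mat n \<pi>) \<rho> M0"
      "\<forall>t<T. \<forall>i<n. \<forall>j<n. 0 < A t $$ (i, j) \<longrightarrow> 0 < M0 t $$ (i, j)"
    using assms(7,9) by blast
  interpret hidden_flow n T A \<pi> \<rho> M0
    using assms(2,3,5) M0 by unfold_locales auto
  have "mat_kernel (observability_mat n A C T) = {0\<^sub>v n} \<longleftrightarrow> observable n T A C"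
    unfolding assms(7) by (rule kernel_observability_mat_iff[OF selection_mat_carrier A_carrier])
  then show ?thesis
    using ex1_optimizer assms(7) by simp
qed

end
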